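(* Let $(\mathrm{Enc},\mathrm{Dec})$ be a quantum tamper-detection code on $t$ shares that is $\varepsilon$-secure against $\mathsf{LO}^t$. Then it is single-share encrypting with error at most $4\sqrt{\varepsilon}$: for all message states $\psi_0,\psi_1$ and every $i\in[t]$, $\|\mathrm{Tr}_{\neg i}\mathrm{Enc}(\psi_0)-\mathrm{Tr}_{\neg i}\mathrm{Enc}(\psi_1)\|_1\le 4\sqrt{\varepsilon}$.
   Context: A quantum code on $t$ shares: CPTP maps $\mathrm{Enc}:\mathcal L(\mathcal H_M)\to\mathcal L(\mathcal H_{X_1}\otimes\cdots\otimes\mathcal H_{X_t})$ and $\mathrm{Dec}$ (which may output a state $\bot$ orthogonal to $\mathcal H_M$), with $\mathrm{Dec}\circ\mathrm{Enc}=\mathrm{id}$. $\mathsf{LO}^t$: channels $\Lambda_1\otimes\cdots\otimes\Lambda_t$ with $\Lambda_i$ CPTP on share $i$. $\varepsilon$-secure tamper detection against $\mathsf{LO}^t$: for every $\Lambda\in\mathsf{LO}^t$ there is $p_\Lambda\in[0,1]$ depending only on $\Lambda$ such that for every $\sigma_M$ with canonical purification $\sigma_{M\hat M}$, $\|(\mathrm{Dec}\circ\Lambda\circ\mathrm{Enc}\otimes\mathrm{id})(\sigma_{M\hat M})-(p_\Lambda\sigma_{M\hat M}+(1-p_\Lambda)\bot\otimes\sigma_{\hat M})\|_1\le\varepsilon$. $\mathrm{Tr}_{\neg i}$ denotes tracing out all shares except the $i$-th. *)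

theory Defs
  imports "Jordan_Normal_Form.Matrix" Complex_Main
begin

definition mtrace :: "complex mat \<Rightarrow> complex" where
  "mtrace A = (\<Sum>i<dim_row A. A $$ (i,i))"

definition cadj :: "complex mat \<Rightarrow> complex mat" where
  "cadj A = mat (dim_col A) (dim_row A) (\<lambda>(i,j). cnj (A $$ (j,i)))"

definition psd :: "nat \<Rightarrow> complex mat \<Rightarrow> bool" where
  "psd n A \<longleftrightarrow> A \<in> carrier_mat n n \<and>
     (\<forall>v :: nat \<Rightarrow> complex.
        Im (\<Sum>i<n. \<Sum>j<n. cnj (v i) * A $$ (i,j) * v j) = 0 \<and>
        Re (\<Sum>i<n. \<Sum>j<n. cnj (v i) * A $$ (i,j) * v j) \<ge> 0)"

definition density :: "nat \<Rightarrow> complex mat \<Rightarrow> bool" where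
  "density n A \<longleftrightarrow> psd n A \<and> mtrace A = 1"

definition msqrt :: "nat \<Rightarrow> complex mat \<Rightarrow> complex mat" where
  "msqrt n A = (THE P. psd n P \<and> P * P = A)"

definition trace_norm :: "complex mat \<Rightarrow> real" where
  "trace_norm A = Re (mtrace (msqrt (dim_col A) (cadj A * A)))"

text \<open>Kronecker product, index of (i,a) is i * dim B + a\<close>
definition kron :: "complex mat \<Rightarrow> complex mat \<Rightarrow> complex mat" where
  "kron A B = mat (dim_row A * dim_row B) (dim_col A * dim_col B)
     (\<lambda>(i,j). A $$ (i div dim_row B, j div dim_col B) * B $$ (i mod dim_row B, j mod dim_col B))"

text \<open>(Phi \<otimes> id_k)(X) for Phi : L(C^n) -> L(C^m), X in L(C^n \<otimes> C^k)\<close>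
definition ext_id :: "(complex mat \<Rightarrow> complex mat) \<Rightarrow> nat \<Rightarrow> nat \<Rightarrow> nat \<Rightarrow> complex mat \<Rightarrow> complex mat" where
  "ext_id Phi n m k X = mat (m*k) (m*k)
     (\<lambda>(u,v). Phi (mat n n (\<lambda>(x,y). X $$ (x*k + u mod k, y*k + v mod k))) $$ (u div k, v div k))"

definition cptp :: "nat \<Rightarrow> nat \<Rightarrow> (complex mat \<Rightarrow> complex mat) \<Rightarrow> bool" where
  "cptp n m Phi \<longleftrightarrow>
     (\<forall>X \<in> carrier_mat n n. Phi X \<in> carrier_mat m m) \<and>
     (\<forall>X \<in> carrier_mat n n. \<forall>Y \<in> carrier_mat n n. Phi (X + Y) = Phi X + Phi Y) \<and>
     (\<forall>X \<in> carrier_mat n n. \<forall>c. Phi (c \<cdot>\<^sub>m X) = c \<cdot>\<^sub>m Phi X) \<and>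
     (\<forall>X \<in> carrier_mat n n. mtrace (Phi X) = mtrace X) \<and>
     (\<forall>k X. psd (n*k) X \<longrightarrow> psd (m*k) (ext_id Phi n m k X))"

text \<open>H_{X_1} \<otimes> ... \<otimes> H_{X_t} with dim H_{X_i} = d i (shares indexed 0..<t),
  share 0 is the most significant tensor factor\<close>
definition tdim :: "(nat \<Rightarrow> nat) \<Rightarrow> nat \<Rightarrow> nat" where
  "tdim d t = (\<Prod>j<t. d j)"

definition stride :: "(nat \<Rightarrow> nat) \<Rightarrow> nat \<Rightarrow> nat \<Rightarrow> nat" where
  "stride d t i = (\<Prod>j\<in>{Suc i..<t}. d j)"

definition digit :: "(nat \<Rightarrow> nat) \<Rightarrow> nat \<Rightarrow> nat \<Rightarrow> nat \<Rightarrow> nat" where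
  "digit d t i x = (x div stride d t i) mod d i"

definition unitm :: "nat \<Rightarrow> nat \<Rightarrow> nat \<Rightarrow> complex mat" where
  "unitm n a b = mat n n (\<lambda>(r,c). if r = a \<and> c = b then 1 else 0)"

text \<open>Lambda_1 \<otimes> ... \<otimes> Lambda_t, defined by linear extension on product basis operators\<close>
definition lo_tensor :: "(nat \<Rightarrow> nat) \<Rightarrow> nat \<Rightarrow> (nat \<Rightarrow> complex mat \<Rightarrow> complex mat) \<Rightarrow> complex mat \<Rightarrow> complex mat" where
  "lo_tensor d t Lam X = mat (tdim d t) (tdim d t)
     (\<lambda>(u,v). \<Sum>x<tdim d t. \<Sum>y<tdim d t. X $$ (x,y) *
        (\<Prod>i<t. Lam i (unitm (d i) (digit d t i x) (digit d t i y)) $$ (digit d t i u, digit d t i v)))"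

definition ptr_keep :: "(nat \<Rightarrow> nat) \<Rightarrow> nat \<Rightarrow> nat \<Rightarrow> complex mat \<Rightarrow> complex mat" where
  "ptr_keep d t i X = mat (d i) (d i)
     (\<lambda>(a,b). \<Sum>x<tdim d t. \<Sum>y<tdim d t.
        if digit d t i x = a \<and> digit d t i y = b \<and> (\<forall>j<t. j \<noteq> i \<longrightarrow> digit d t j x = digit d t j y)
        then X $$ (x,y) else 0)"

text \<open>zero-padding: embeds an operator into a larger space (H_M into H_M \<oplus> span bot)\<close>
definition pad :: "nat \<Rightarrow> complex mat \<Rightarrow> complex mat" where
  "pad m S = mat m m (\<lambda>(u,v). if u < dim_row S \<and> v < dim_col S then S $$ (u,v) else 0)"

text \<open>the state bot on C^(dM+1) = H_M \<oplus> span{bot}\<close>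
definition botm :: "nat \<Rightarrow> complex mat" where
  "botm dM = mat (Suc dM) (Suc dM) (\<lambda>(i,j). if i = dM \<and> j = dM then 1 else 0)"

text \<open>canonical purification sigma_{M Mhat} = |s><s|, |s> = (sqrt sigma \<otimes> I) sum_j |j>|j>\<close>
definition canon_pur :: "nat \<Rightarrow> complex mat \<Rightarrow> complex mat" where
  "canon_pur dM \<sigma> = (let P = msqrt dM \<sigma> in
     mat (dM*dM) (dM*dM) (\<lambda>(u,v). P $$ (u div dM, u mod dM) * cnj (P $$ (v div dM, v mod dM))))"

definition ptr_first :: "nat \<Rightarrow> nat \<Rightarrow> complex mat \<Rightarrow> complex mat" where
  "ptr_first n k S = mat k k (\<lambda>(a,b). \<Sum>x<n. S $$ (x*k + a, x*k + b))"

definition is_code :: "nat \<Rightarrow> (nat \<Rightarrow> nat) \<Rightarrow> nat \<Rightarrow> (complex mat \<Rightarrow> complex mat) \<Rightarrow> (complex mat \<Rightarrow> complex mat) \<Rightarrow> bool" where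
  "is_code dM d t Enc Dec \<longleftrightarrow>
     cptp dM (tdim d t) Enc \<and> cptp (tdim d t) (Suc dM) Dec \<and>
     (\<forall>\<rho> \<in> carrier_mat dM dM. Dec (Enc \<rho>) = pad (Suc dM) \<rho>)"

definition tamper_detect_LO :: "nat \<Rightarrow> (nat \<Rightarrow> nat) \<Rightarrow> nat \<Rightarrow> (complex mat \<Rightarrow> complex mat) \<Rightarrow> (complex mat \<Rightarrow> complex mat) \<Rightarrow> real \<Rightarrow> bool" where
  "tamper_detect_LO dM d t Enc Dec \<epsilon> \<longleftrightarrow>
     (\<forall>Lam. (\<forall>i<t. cptp (d i) (d i) (Lam i)) \<longrightarrow>
       (\<exists>p::real. 0 \<le> p \<and> p \<le> 1 \<and>
         (\<forall>\<sigma>. density dM \<sigma> \<longrightarrow>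
            (let S = canon_pur dM \<sigma> in
             trace_norm (ext_id (Dec \<circ> lo_tensor d t Lam \<circ> Enc) dM (Suc dM) dM S
                - (complex_of_real p \<cdot>\<^sub>m pad (Suc dM * dM) S
                   + complex_of_real (1 - p) \<cdot>\<^sub>m kron (botm dM) (ptr_first dM dM S))) \<le> \<epsilon>))))"

end

theory Submission
  imports Defs "Jordan_Normal_Form.Schur_Decomposition" "Jordan_Normal_Form.Spectral_Radius"
begin

text \<open>
  Diagonalise \<open>\<psi>\<^sub>0 - \<psi>\<^sub>1 = U diag(l) U\<^sup>*\<close> and put \<open>L = \<Sum>\<bar>l\<^sub>k\<bar> \<le> 2\<close>. The message
  \<open>\<sigma> = U diag(\<bar>l\<bar>/L) U\<^sup>*\<close> has the canonical purification \<open>P = \<surd>\<sigma>\<close>, and \<open>F = U diag(sgn l \<surd>(\<bar>l\<bar>/L)) U\<^sup>*\<close>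
  is a unit vector orthogonal to \<open>P\<close> with \<open>P F\<^sup>* = (\<psi>\<^sub>0 - \<psi>\<^sub>1)/L\<close>. Tamper with share \<open>i\<close> by the
  unitary \<open>A\<close> for which \<open>tr(A \<Delta>) = \<parallel>\<Delta>\<parallel>\<^sub>1\<close>, where \<open>\<Delta>\<close> is the difference of the two marginals.
  Neither \<open>P\<close> nor \<open>\<bottom>\<close> overlaps with \<open>F\<close>, so security bounds the overlap of the decoded state with
  \<open>F\<close> by \<open>\<epsilon>\<close>. By Cauchy--Schwarz this overlap is at least \<open>\<bar>tr(A Enc(P F\<^sup>*))\<bar>\<^sup>2 = (\<parallel>\<Delta>\<parallel>\<^sub>1/L)\<^sup>2\<close>,
  because an untampered codeword of \<open>F\<close> decodes to \<open>F\<close>. Hence \<open>\<parallel>\<Delta>\<parallel>\<^sub>1 \<le> 2\<surd>\<epsilon>\<close>.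
\<close>

section \<open>Adjoints and the spectral theorem\<close>

declare index_mult_mat(1) [simp del]

section \<open>Entrywise calculus of adjoints, unitaries and diagonal matrices\<close>

lemma square_mult_carrier [simp]:
  "A \<in> carrier_mat n n \<Longrightarrow> B \<in> carrier_mat n n \<Longrightarrow> A * B \<in> carrier_mat n n"
  by simp

lemma cadj_carrier [simp, intro]: "A \<in> carrier_mat n m \<Longrightarrow> cadj A \<in> carrier_mat m n"
  by (simp add: cadj_def)

lemma dim_cadj [simp]: "dim_row (cadj A) = dim_col A" "dim_col (cadj A) = dim_row A"
  by (simp_all add: cadj_def)

lemma index_cadj [simp]: "i < dim_col A \<Longrightarrow> j < dim_row A \<Longrightarrow> cadj A $$ (i,j) = cnj (A $$ (j,i))"
  by (simp add: cadj_def)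

lemma cadj_cadj [simp]: "cadj (cadj A) = A"
  by (rule eq_matI) auto

text \<open>Entries of products are expanded into explicit sums through this rule; the default rule
  in terms of scalar products of rows and columns was removed from the simpset for that
  reason.\<close>

lemma index_mult_mat_sum:
  assumes "A \<in> carrier_mat n m" "B \<in> carrier_mat m k" "i < n" "j < k"
  shows "(A * B) $$ (i,j) = (\<Sum>l<m. A $$ (i,l) * B $$ (l,j))"
  using assms by (auto simp: index_mult_mat(1) scalar_prod_def lessThan_atLeast0 intro!: sum.cong)

lemma index_cadj_mult_sum:
  assumes "A \<in> carrier_mat n m" "B \<in> carrier_mat n k" "i < m" "j < k"
  shows "(cadj A * B) $$ (i,j) = (\<Sum>l<n. cnj (A $$ (l,i)) * B $$ (l,j))"
  using assms by (subst index_mult_mat_sum[where n=m and m=n and k=k]) (auto intro!: sum.cong)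

lemma cadj_mult:
  assumes "A \<in> carrier_mat n m" "B \<in> carrier_mat m k"
  shows "cadj (A * B) = cadj B * cadj A"
proof (rule eq_matI)
  fix i j assume "i < dim_row (cadj B * cadj A)" "j < dim_col (cadj B * cadj A)"
  with assms have ij: "i < k" "j < n" by auto
  have "cadj (A * B) $$ (i,j) = (\<Sum>l<m. cnj (A $$ (j,l)) * cnj (B $$ (l,i)))"
    using assms ij by (simp add: index_mult_mat_sum[OF assms])
  also have "\<dots> = (cadj B * cadj A) $$ (i,j)"
    using assms ij by (subst index_mult_mat_sum[where n=k and m=m and k=n]) (auto intro!: sum.cong)
  finally show "cadj (A * B) $$ (i,j) = (cadj B * cadj A) $$ (i,j)" .
qed (use assms in auto)

definition unitary :: "nat \<Rightarrow> complex mat \<Rightarrow> bool" where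
  "unitary n U \<longleftrightarrow> U \<in> carrier_mat n n \<and> cadj U * U = 1\<^sub>m n \<and> U * cadj U = 1\<^sub>m n"

text \<open>For square matrices a left inverse is also a right inverse, so one of the two identities
  suffices.\<close>

lemma unitaryI: "U \<in> carrier_mat n n \<Longrightarrow> cadj U * U = 1\<^sub>m n \<Longrightarrow> unitary n U"
  using mat_mult_left_right_inverse[of "cadj U" n U] by (auto simp: unitary_def)

lemma unitaryD:
  assumes "unitary n U"
  shows "U \<in> carrier_mat n n" "cadj U \<in> carrier_mat n n" "cadj U * U = 1\<^sub>m n" "U * cadj U = 1\<^sub>m n"
  using assms by (auto simp: unitary_def)

lemma unitary_mult:
  assumes U: "unitary n U" and V: "unitary n V"
  shows "unitary n (U * V)"
proof (rule unitaryI)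
  note [simp] = unitaryD(1,2)[OF U] unitaryD(1,2)[OF V]
  have "cadj (U * V) * (U * V) = cadj V * (cadj U * (U * V))"
    by (simp add: cadj_mult[of U n n V n] assoc_mult_mat[of _ n n _ n _ n])
  also have "\<dots> = cadj V * ((cadj U * U) * V)"
    by (simp add: assoc_mult_mat[of "cadj U" n n U n V n])
  also have "\<dots> = 1\<^sub>m n" by (simp add: unitaryD(3)[OF U] unitaryD(3)[OF V] left_mult_one_mat[of V n n])
  finally show "cadj (U * V) * (U * V) = 1\<^sub>m n" .
qed (use unitaryD(1)[OF U] unitaryD(1)[OF V] in auto)

definition dmat :: "nat \<Rightarrow> (nat \<Rightarrow> complex) \<Rightarrow> complex mat" where
  "dmat n f = mat n n (\<lambda>(i,j). if i = j then f i else 0)"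

lemma dmat_carrier [simp, intro]: "dmat n f \<in> carrier_mat n n"
  by (simp add: dmat_def)

lemma dim_dmat [simp]: "dim_row (dmat n f) = n" "dim_col (dmat n f) = n"
  by (simp_all add: dmat_def)

lemma index_dmat [simp]: "i < n \<Longrightarrow> j < n \<Longrightarrow> dmat n f $$ (i,j) = (if i = j then f i else 0)"
  by (simp add: dmat_def)

lemma cadj_dmat: "cadj (dmat n f) = dmat n (\<lambda>i. cnj (f i))"
  by (rule eq_matI) (auto simp: dmat_def)

lemma index_dmat_mult:
  "M \<in> carrier_mat n m \<Longrightarrow> i < n \<Longrightarrow> j < m \<Longrightarrow> (dmat n f * M) $$ (i,j) = f i * M $$ (i,j)"
  by (subst index_mult_mat_sum[where n=n and m=n and k=m]) (auto simp: dmat_def if_distrib if_distribR sum.delta cong: if_cong)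

lemma index_mult_dmat:
  "M \<in> carrier_mat m n \<Longrightarrow> i < m \<Longrightarrow> j < n \<Longrightarrow> (M * dmat n f) $$ (i,j) = M $$ (i,j) * f j"
  by (subst index_mult_mat_sum[where n=m and m=n and k=n]) (auto simp: dmat_def if_distrib if_distribR sum.delta' cong: if_cong)

lemma dmat_mult: "dmat n f * dmat n g = dmat n (\<lambda>i. f i * g i)"
  by (rule eq_matI) (simp_all add: index_dmat_mult[OF dmat_carrier])

section \<open>Unitary diagonalisation of hermitian matrices\<close>

lemma unitary_normalized_corthogonal:
  fixes W :: "complex mat"
  assumes W: "W \<in> carrier_mat n n" and o: "corthogonal_mat W"
  defines "s \<equiv> \<lambda>j. Re (\<Sum>i<n. W $$ (i,j) * cnj (W $$ (i,j)))"
  shows "unitary n (W * dmat n (\<lambda>j. complex_of_real (1 / sqrt (s j))))"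
proof -
  let ?U = "W * dmat n (\<lambda>j. complex_of_real (1 / sqrt (s j)))"
  \<comment> \<open>\<open>corthogonal_mat\<close> says two things at once: distinct columns are
    orthogonal, and no column has norm zero. The second makes the division by
    \<open>sqrt (s j)\<close> legitimate.\<close>
  have ip: "(\<Sum>i<n. W $$ (i,j) * cnj (W $$ (i,k))) = 0 \<longleftrightarrow> j \<noteq> k" if "j < n" "k < n" for j k
    using corthogonal_matD[OF o, of j k] W that
    by (simp add: scalar_prod_def lessThan_atLeast0)
  have sj: "(\<Sum>i<n. W $$ (i,j) * cnj (W $$ (i,j))) = complex_of_real (s j)" for j
    by (simp add: s_def complex_eq_iff)
  have s0: "s j \<ge> 0" for j unfolding s_def Re_sum by (intro sum_nonneg) simp
  have spos: "s j > 0" if "j < n" for j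
    using ip[OF that that] s0[of j] unfolding sj by (cases "s j = 0") auto
  have U: "?U \<in> carrier_mat n n" using W by auto
  show "unitary n ?U"
  proof (rule unitaryI[OF U], rule eq_matI)
    fix i j assume "i < dim_row (1\<^sub>m n :: complex mat)" "j < dim_col (1\<^sub>m n :: complex mat)"
    then have ij: "i < n" "j < n" by auto
    have "(cadj ?U * ?U) $$ (i,j) = (\<Sum>l<n. cnj (?U $$ (l,i)) * ?U $$ (l,j))"
      by (rule index_cadj_mult_sum[OF U U ij])
    also have "\<dots> = (\<Sum>l<n. W $$ (l,j) * cnj (W $$ (l,i))) * complex_of_real (1 / sqrt (s i) * (1 / sqrt (s j)))"
      unfolding sum_distrib_right
      using U ij W by (intro sum.cong refl) (auto simp: index_mult_dmat[OF W])
    also have "\<dots> = (1\<^sub>m n) $$ (i,j)"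
    proof (cases "i = j")
      case True
      have "s j * (1 / sqrt (s j) * (1 / sqrt (s j))) = 1"
        using spos[OF ij(2)] by (simp add: field_simps)
      then show ?thesis using True ij by (simp add: sj flip: of_real_mult)
    next
      case False
      then show ?thesis using ip[of j i] ij by simp
    qed
    finally show "(cadj ?U * ?U) $$ (i,j) = (1\<^sub>m n) $$ (i,j)" .
  qed (use W in auto)
qed

text \<open>An eigenvector is completed to a basis, orthogonalised and normalised. If column 0 of
  \<open>U\<close> is an eigenvector for \<open>e\<close>, then column 0 of \<open>A * U\<close> is
  \<open>e\<close> times column 0 of \<open>U\<close>, and \<open>cadj U\<close> turns this into
  \<open>e\<close> times the first basis vector.\<close>

lemma unitary_with_eigenvector_first_col:
  fixes A :: "complex mat"
  assumes A: "A \<in> carrier_mat n n" and n: "n > 0"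
  obtains U e where "unitary n U" "\<And>i. i < n \<Longrightarrow> (cadj U * A * U) $$ (i,0) = (if i = 0 then e else 0)"
proof -
  from spectrum_non_empty[OF A n] obtain e where e: "eigenvalue A e"
    unfolding spectrum_def by auto
  define v where "v = find_eigenvector A e"
  have ev: "eigenvector A v e" unfolding v_def using find_eigenvector[OF A e] .
  then have v: "v \<in> carrier_vec n" and v0: "v \<noteq> 0\<^sub>v n" and Av: "A *\<^sub>v v = e \<cdot>\<^sub>v v"
    using A unfolding eigenvector_def by auto
  define b where "b = basis_completion v"
  define ws where "ws = gram_schmidt n b"
  define W where "W = mat_of_cols n ws"
  interpret cof_vec_space n "TYPE(complex)" .
  from basis_completion[OF v v0, folded b_def]
  have dist_b: "distinct b" and indep: "\<not> lin_dep (set b)" and b: "set b \<subseteq> carrier_vec n"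
    and hdb: "hd b = v" and len_b: "length b = n" by auto
  from hdb len_b n obtain vs where bv: "b = v # vs" by (cases b, auto)
  from gram_schmidt_result[OF b dist_b indep refl, folded ws_def]
  have ws: "set ws \<subseteq> carrier_vec n" "corthogonal ws" "length ws = n"
    by (auto simp: len_b)
  \<comment> \<open>Gram-Schmidt does not change the head of the list, so column 0 of
    \<open>W\<close> is still the eigenvector.\<close>
  from gram_schmidt_hd[OF v, of vs, folded bv] have hdws: "hd ws = v" unfolding ws_def .
  have o: "corthogonal_mat W" using orthogonal_mat_of_cols[OF ws] unfolding W_def .
  have W: "W \<in> carrier_mat n n" using ws unfolding W_def using mat_of_cols_carrier(1)[of n ws] by auto
  define s where "s = (\<lambda>j. Re (\<Sum>i<n. W $$ (i,j) * cnj (W $$ (i,j))))"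
  define U where "U = W * dmat n (\<lambda>j. complex_of_real (1 / sqrt (s j)))"
  have un: "unitary n U"
    unfolding U_def s_def by (rule unitary_normalized_corthogonal[OF W o])
  note Uc = unitaryD[OF un]
  have W0: "W $$ (i,0) = v $ i" if "i < n" for i
  proof -
    have "ws ! 0 = v" using hdws ws(3) n by (cases ws) auto
    then show ?thesis using that ws n unfolding W_def by (simp add: mat_of_cols_index)
  qed
  have AU: "(A * U) $$ (i,0) = e * U $$ (i,0)" if i: "i < n" for i
  proof -
    have "(\<Sum>l<n. A $$ (i,l) * v $ l) = e * v $ i"
      using arg_cong[OF Av, of "\<lambda>x. x $ i"] i A v by (simp add: scalar_prod_def lessThan_atLeast0)
    then have "(\<Sum>l<n. A $$ (i,l) * v $ l) * complex_of_real (1 / sqrt (s 0)) = e * v $ i * complex_of_real (1 / sqrt (s 0))"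
      by simp
    moreover have Ul: "U $$ (l,0) = v $ l * complex_of_real (1 / sqrt (s 0))" if "l < n" for l
      unfolding U_def using index_mult_dmat[OF W that n] W0[OF that] by simp
    moreover have "(A * U) $$ (i,0) = (\<Sum>l<n. A $$ (i,l) * v $ l) * complex_of_real (1 / sqrt (s 0))"
      unfolding index_mult_mat_sum[OF A Uc(1) i n] sum_distrib_right
      by (intro sum.cong refl) (simp add: Ul)
    ultimately show ?thesis using Ul[OF i] by simp
  qed
  have "(cadj U * A * U) $$ (i,0) = (if i = 0 then e else 0)" if i: "i < n" for i
  proof -
    have "cadj U * A * U = cadj U * (A * U)" using A Uc by (simp add: assoc_mult_mat[of _ n n _ n _ n])
    then have "(cadj U * A * U) $$ (i,0) = (\<Sum>l<n. cadj U $$ (i,l) * (A * U) $$ (l,0))"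
      using i n A Uc by (simp only:) (rule index_mult_mat_sum, auto)
    also have "\<dots> = e * (\<Sum>l<n. cadj U $$ (i,l) * U $$ (l,0))"
      unfolding sum_distrib_left by (intro sum.cong refl) (simp add: AU)
    also have "(\<Sum>l<n. cadj U $$ (i,l) * U $$ (l,0)) = (1\<^sub>m n) $$ (i,0)"
      unfolding Uc(3)[symmetric] using i n Uc by (intro index_mult_mat_sum[symmetric]) auto
    finally show ?thesis using i n by simp
  qed
  with un that show ?thesis by blast
qed

lemma four_block_decomp_first:
  assumes "B \<in> carrier_mat (Suc n) (Suc n)"
    and "\<And>i. i < Suc n \<Longrightarrow> B $$ (i,0) = (if i = 0 then e else 0)"
    and "\<And>i. i < Suc n \<Longrightarrow> B $$ (0,i) = (if i = 0 then e else 0)"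
  shows "B = four_block_mat (mat 1 1 (\<lambda>_. e)) (0\<^sub>m 1 n) (0\<^sub>m n 1) (mat n n (\<lambda>(i,j). B $$ (Suc i, Suc j)))"
  using assms by (intro eq_matI) (auto simp: not_less)

lemma cadj_four_block:
  assumes "A \<in> carrier_mat a b" "B \<in> carrier_mat a d" "C \<in> carrier_mat c b" "D \<in> carrier_mat c d"
  shows "cadj (four_block_mat A B C D) = four_block_mat (cadj A) (cadj C) (cadj B) (cadj D)"
  using assms by (intro eq_matI) auto

text \<open>Deflation by induction on the dimension: after one eigenvector is split off, hermitian
  symmetry clears row 0 along with column 0, and the induction hypothesis diagonalises the remaining
  block.\<close>

lemma hermitian_spectral:
  assumes "A \<in> carrier_mat n n" "cadj A = A"
  shows "\<exists>U l. unitary n U \<and> A = U * dmat n (\<lambda>i. complex_of_real (l i)) * cadj U"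
  using assms
proof (induction n arbitrary: A)
  case 0
  have "unitary 0 A" using 0 by (intro unitaryI eq_matI) auto
  then show ?case using 0 by (intro exI[of _ A] exI[of _ "\<lambda>_. 0"] conjI eq_matI) auto
next
  case (Suc n)
  let ?N = "Suc n"
  from unitary_with_eigenvector_first_col[OF Suc.prems(1)] obtain U e where U: "unitary ?N U"
    and c0: "\<And>i. i < ?N \<Longrightarrow> (cadj U * A * U) $$ (i,0) = (if i = 0 then e else 0)" by blast
  note Uc = unitaryD[OF U]
  define B where "B = cadj U * A * U"
  have B: "B \<in> carrier_mat ?N ?N" unfolding B_def using Uc Suc.prems by auto
  have Bh: "cadj B = B"
    unfolding B_def using Uc Suc.prems
    by (simp add: cadj_mult[of _ ?N ?N _ ?N] assoc_mult_mat[of _ ?N ?N _ ?N _ ?N])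
  have Bij: "B $$ (i,j) = cnj (B $$ (j,i))" if "i < ?N" "j < ?N" for i j
    using arg_cong[OF Bh, of "\<lambda>M. M $$ (i,j)"] that B by simp
  note c0 = c0[folded B_def]
  \<comment> \<open>A diagonal entry of a hermitian matrix is its own conjugate, so the eigenvalue
    is real.\<close>
  have ereal: "e = complex_of_real (Re e)"
    using Bij[of 0 0] c0[of 0] by (auto simp: complex_eq_iff)
  have r0: "B $$ (0,i) = (if i = 0 then e else 0)" if "i < ?N" for i
    using Bij[of 0 i] c0[of i] ereal that by (auto simp: complex_eq_iff)
  define B3 where "B3 = mat n n (\<lambda>(i,j). B $$ (Suc i, Suc j))"
  have Bb: "B = four_block_mat (mat 1 1 (\<lambda>_. e)) (0\<^sub>m 1 n) (0\<^sub>m n 1) B3"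
    unfolding B3_def by (rule four_block_decomp_first[OF B c0 r0])
  have B3: "B3 \<in> carrier_mat n n" unfolding B3_def by auto
  have "cadj B3 = B3"
    unfolding B3_def by (rule eq_matI) (auto simp: Bij[symmetric])
  from Suc.IH[OF B3 this] obtain V l where V: "unitary n V"
    and B3V: "B3 = V * dmat n (\<lambda>i. complex_of_real (l i)) * cadj V" by blast
  note Vc = unitaryD[OF V]
  let ?D = "dmat n (\<lambda>i. complex_of_real (l i))"
  define W where "W = four_block_mat (1\<^sub>m 1) (0\<^sub>m 1 n) (0\<^sub>m n 1) V"
  have W: "W \<in> carrier_mat ?N ?N" unfolding W_def using Vc four_block_carrier_mat[of "1\<^sub>m 1" 1 1 V n n] by auto
  have c1: "cadj (1\<^sub>m 1) = 1\<^sub>m 1" "cadj (0\<^sub>m 1 n) = 0\<^sub>m n 1" "cadj (0\<^sub>m n 1) = 0\<^sub>m 1 n"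
    by (auto intro!: eq_matI)
  have cW: "cadj W = four_block_mat (1\<^sub>m 1) (0\<^sub>m 1 n) (0\<^sub>m n 1) (cadj V)"
    unfolding W_def by (subst cadj_four_block[where a=1 and b=1 and c=n and d=n]) (use Vc c1 in auto)
  have uW: "unitary ?N W"
  proof (rule unitaryI[OF W])
    have "cadj W * W = four_block_mat (1\<^sub>m 1) (0\<^sub>m 1 n) (0\<^sub>m n 1) (1\<^sub>m n)"
      unfolding cW unfolding W_def
      by (subst mult_four_block_mat[of _ 1 1 _ n _ n _ _ 1 _ n])
         (use Vc in auto)
    also have "\<dots> = 1\<^sub>m ?N" by (rule eq_matI) auto
    finally show "cadj W * W = 1\<^sub>m ?N" .
  qed
  \<comment> \<open>The new eigenvalue takes index 0; those of the smaller block move up by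
    one.\<close>
  define k where "k = (\<lambda>i. if i = 0 then Re e else l (i - 1))"
  have Db: "dmat ?N (\<lambda>i. complex_of_real (k i)) = four_block_mat (mat 1 1 (\<lambda>_. e)) (0\<^sub>m 1 n) (0\<^sub>m n 1) ?D"
    using ereal by (intro eq_matI) (auto simp: dmat_def k_def)
  have "W * dmat ?N (\<lambda>i. complex_of_real (k i)) * cadj W = B"
  proof -
    let ?E = "mat 1 1 (\<lambda>_. e)"
    have "W * dmat ?N (\<lambda>i. complex_of_real (k i)) = four_block_mat ?E (0\<^sub>m 1 n) (0\<^sub>m n 1) (V * ?D)"
      unfolding Db W_def using Vc(1)
      by (subst mult_four_block_mat[of _ 1 1 _ n _ n _ _ 1 _ n])
         (auto simp: left_mult_zero_mat[of _ n n])
    also have "\<dots> * cadj W = four_block_mat ?E (0\<^sub>m 1 n) (0\<^sub>m n 1) (V * ?D * cadj V)"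
      unfolding cW using Vc(1,2) square_mult_carrier[OF Vc(1) dmat_carrier]
      by (subst mult_four_block_mat[of _ 1 1 _ n _ n _ _ 1 _ n]) auto
    finally show ?thesis unfolding Bb B3V .
  qed
  then have eqB: "W * dmat ?N (\<lambda>i. complex_of_real (k i)) * cadj W = cadj U * A * U" unfolding B_def .
  note [simp] = W Uc(1,2) Suc.prems(1)
  \<comment> \<open>Undoing the first conjugation makes \<open>U * W\<close> the diagonalising
    unitary.\<close>
  have "A = (U * cadj U) * A * (U * cadj U)"
    by (simp add: Uc(4) left_mult_one_mat[OF Suc.prems(1)] right_mult_one_mat[OF Suc.prems(1)])
  also have "\<dots> = U * (cadj U * A * U) * cadj U"
    by (simp add: assoc_mult_mat[of _ ?N ?N _ ?N _ ?N])
  also have "\<dots> = (U * W) * dmat ?N (\<lambda>i. complex_of_real (k i)) * cadj (U * W)"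
    unfolding eqB[symmetric] by (simp add: cadj_mult[of _ ?N ?N _ ?N] assoc_mult_mat[of _ ?N ?N _ ?N _ ?N])
  finally show ?case using unitary_mult[OF U uW] by blast
qed

section \<open>Positive semidefinite kernels\<close>

text \<open>Sesquilinear forms are taken over kernels on an arbitrary index set, not over matrices,
  because later indices are pairs of system and reference coordinates, also with a boolean branch
  tag.\<close>

definition sform :: "'a set \<Rightarrow> ('a \<Rightarrow> 'a \<Rightarrow> complex) \<Rightarrow> ('a \<Rightarrow> complex) \<Rightarrow> ('a \<Rightarrow> complex) \<Rightarrow> complex" where
  "sform I K v w = (\<Sum>i\<in>I. \<Sum>j\<in>I. cnj (v i) * K i j * w j)"

definition pos_kernel :: "'a set \<Rightarrow> ('a \<Rightarrow> 'a \<Rightarrow> complex) \<Rightarrow> bool" where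
  "pos_kernel I K \<longleftrightarrow> (\<forall>v. Im (sform I K v v) = 0 \<and> Re (sform I K v v) \<ge> 0)"

lemma psd_iff_pos_kernel: "psd n A \<longleftrightarrow> A \<in> carrier_mat n n \<and> pos_kernel {..<n} (\<lambda>i j. A $$ (i,j))"
  by (simp add: psd_def pos_kernel_def sform_def)

lemma sform_lincomb:
  "sform I K (\<lambda>i. v i + s * w i) (\<lambda>i. v i + s * w i)
   = sform I K v v + s * sform I K v w + cnj s * sform I K w v + cnj s * s * sform I K w w"
  unfolding sform_def sum_distrib_left sum.distrib[symmetric]
  by (intro sum.cong refl) (simp add: algebra_simps)

lemma pos_kernel_real: "pos_kernel I K \<Longrightarrow> sform I K v v = complex_of_real (Re (sform I K v v))"
  by (simp add: pos_kernel_def complex_eq_iff)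

text \<open>Polarisation: realness of the quadratic form at \<open>v + w\<close> fixes the imaginary
  parts of the two cross terms, realness at \<open>v + \<i> * w\<close> their real parts.\<close>

lemma pos_kernel_hermitian:
  assumes "pos_kernel I K"
  shows "sform I K w v = cnj (sform I K v w)"
proof -
  have q: "Im (sform I K u u) = 0" for u using assms by (simp add: pos_kernel_def)
  show ?thesis
    using q[of "\<lambda>i. v i + 1 * w i"] q[of "\<lambda>i. v i + \<i> * w i"] q[of v] q[of w]
    unfolding sform_lincomb by (simp add: complex_eq_iff)
qed

text \<open>Nonnegativity of the quadratic form along a line through \<open>v\<close> in direction
  \<open>w\<close>. The form may be degenerate, so a vanishing value at \<open>w\<close> is a
  separate case.\<close>

lemma pos_kernel_Cauchy_Schwarz:
  assumes P: "pos_kernel I K"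
  shows "(cmod (sform I K v w))\<^sup>2 \<le> Re (sform I K v v) * Re (sform I K w w)"
proof -
  define z a b where "z = sform I K v w" and "a = Re (sform I K v v)" and "b = Re (sform I K w w)"
  have zz: "sform I K w v = cnj z" unfolding z_def by (rule pos_kernel_hermitian[OF P])
  have ab: "sform I K v v = complex_of_real a" "sform I K w w = complex_of_real b"
    unfolding a_def b_def using pos_kernel_real[OF P] by auto
  have pos: "0 \<le> a" "0 \<le> b" using P unfolding a_def b_def pos_kernel_def by auto
  have q: "0 \<le> a - 2 * r * (cmod z)\<^sup>2 + r\<^sup>2 * (cmod z)\<^sup>2 * b" for r :: real
  proof -
    \<comment> \<open>The phase \<open>cnj z\<close> makes both cross terms equal to the real number
      \<open>- r * (cmod z)\<^sup>2\<close>.\<close>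
    let ?s = "- complex_of_real r * cnj z"
    have "sform I K (\<lambda>i. v i + ?s * w i) (\<lambda>i. v i + ?s * w i)
        = complex_of_real (a - 2 * r * (cmod z)\<^sup>2 + r\<^sup>2 * (cmod z)\<^sup>2 * b)"
      unfolding sform_lincomb ab zz z_def[symmetric]
      by (simp add: complex_eq_iff cmod_power2) (simp add: algebra_simps power2_eq_square)
    moreover have "0 \<le> Re (sform I K (\<lambda>i. v i + ?s * w i) (\<lambda>i. v i + ?s * w i))"
      using P by (simp add: pos_kernel_def)
    ultimately show ?thesis by (metis Re_complex_of_real)
  qed
  have "(cmod z)\<^sup>2 \<le> a * b"
  proof (cases "b = 0")
    case True
    have "cmod z = 0"
    proof (rule ccontr)
      assume "cmod z \<noteq> 0"
      \<comment> \<open>With \<open>b = 0\<close> the bound is linear in \<open>r\<close>; this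
        \<open>r\<close> gives it the value -1.\<close>
      then show False using q[of "(a + 1) / (2 * (cmod z)\<^sup>2)"] True pos by simp
    qed
    then show ?thesis using True by simp
  next
    case False
    with pos have "b > 0" by simp
    \<comment> \<open>\<open>r = 1 / b\<close> minimises the quadratic polynomial in
      \<open>r\<close>.\<close>
    then show ?thesis using q[of "1 / b"] by (simp add: power2_eq_square field_simps)
  qed
  then show ?thesis by (simp add: z_def a_def b_def)
qed

lemma sform_identity: "finite I \<Longrightarrow> sform I (\<lambda>i j. if i = j then 1 else 0) v w = (\<Sum>i\<in>I. cnj (v i) * w i)"
  unfolding sform_def by (intro sum.cong refl) (simp add: if_distrib if_distribR sum.delta' cong: if_cong)

lemma cnj_mult_self: "cnj z * z = complex_of_real ((cmod z)\<^sup>2)"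
  by (metis complex_norm_square mult.commute of_real_power)

lemma complex_Cauchy_Schwarz_sum:
  assumes "finite I"
  shows "(cmod (\<Sum>i\<in>I. cnj (v i) * w i))\<^sup>2 \<le> (\<Sum>i\<in>I. (cmod (v i))\<^sup>2) * (\<Sum>i\<in>I. (cmod (w i))\<^sup>2)"
proof -
  let ?K = "\<lambda>i j. if i = j then 1 else 0 :: complex"
  have self: "sform I ?K v v = complex_of_real (\<Sum>i\<in>I. (cmod (v i))\<^sup>2)" for v
    unfolding sform_identity[OF assms] cnj_mult_self by simp
  then have "pos_kernel I ?K" unfolding pos_kernel_def by (auto intro: sum_nonneg)
  from pos_kernel_Cauchy_Schwarz[OF this, of v w] show ?thesis
    unfolding self unfolding sform_identity[OF assms] by simp
qed

section \<open>Constructions that preserve positivity: reindexing, rank one, compression\<close>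

lemma sform_reindex:
  assumes "bij_betw h I J"
  shows "sform I (\<lambda>i j. K (h i) (h j)) (\<lambda>i. v (h i)) (\<lambda>i. w (h i)) = sform J K v w"
  unfolding sform_def
  by (subst (2) sum.reindex_bij_betw[OF assms, symmetric], rule sum.cong[OF refl],
      rule sum.reindex_bij_betw[OF assms])

lemma pos_kernel_reindex:
  assumes h: "bij_betw h I J"
  shows "pos_kernel I (\<lambda>i j. K (h i) (h j)) \<longleftrightarrow> pos_kernel J K"
proof
  assume "pos_kernel J K"
  moreover have "sform I (\<lambda>i j. K (h i) (h j)) v v = sform J K (\<lambda>j. v (inv_into I h j)) (\<lambda>j. v (inv_into I h j))" for v
    unfolding sform_reindex[OF h, symmetric] unfolding sform_def
    using bij_betw_inv_into_left[OF h] by (intro sum.cong refl) auto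
  ultimately show "pos_kernel I (\<lambda>i j. K (h i) (h j))" by (simp add: pos_kernel_def)
next
  assume "pos_kernel I (\<lambda>i j. K (h i) (h j))"
  then show "pos_kernel J K" unfolding pos_kernel_def sform_reindex[OF h, symmetric] by simp
qed

lemma sform_cong:
  "(\<And>i j. i \<in> I \<Longrightarrow> j \<in> I \<Longrightarrow> K i j = L i j) \<Longrightarrow> sform I K v w = sform I L v w"
  unfolding sform_def by (intro sum.cong refl) auto

lemma pos_kernel_cong:
  "(\<And>i j. i \<in> I \<Longrightarrow> j \<in> I \<Longrightarrow> K i j = L i j) \<Longrightarrow> pos_kernel I K \<longleftrightarrow> pos_kernel I L"
  unfolding pos_kernel_def by (simp cong: sform_cong)

text \<open>The quadratic form is the squared modulus of the inner product with
  \<open>a\<close>.\<close>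

lemma pos_kernel_rank_one: "pos_kernel I (\<lambda>i j. a i * cnj (a j))"
proof -
  have "sform I (\<lambda>i j. a i * cnj (a j)) v v = complex_of_real ((cmod (\<Sum>j\<in>I. cnj (a j) * v j))\<^sup>2)" for v
    unfolding cnj_mult_self[symmetric] sform_def cnj_sum sum_product
    by (intro sum.cong refl) (simp add: algebra_simps)
  then show ?thesis by (simp add: pos_kernel_def)
qed

lemma sum_rotate:
  "(\<Sum>i\<in>A. \<Sum>j\<in>B. \<Sum>k\<in>C. f i j k) = (\<Sum>k\<in>C. \<Sum>i\<in>A. \<Sum>j\<in>B. f i j k)"
proof -
  have "(\<Sum>i\<in>A. \<Sum>j\<in>B. \<Sum>k\<in>C. f i j k) = (\<Sum>i\<in>A. \<Sum>k\<in>C. \<Sum>j\<in>B. f i j k)"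
    by (intro sum.cong refl sum.swap)
  also have "\<dots> = (\<Sum>k\<in>C. \<Sum>i\<in>A. \<Sum>j\<in>B. f i j k)" by (rule sum.swap)
  finally show ?thesis .
qed

text \<open>This is the congruence of \<open>K\<close> by a rectangular matrix \<open>B\<close>: its
  form at \<open>v\<close> is the form of \<open>K\<close> at the adjoint of \<open>B\<close>
  applied to \<open>v\<close>.\<close>

lemma pos_kernel_compress:
  assumes "pos_kernel I K"
  shows "pos_kernel J (\<lambda>a b. \<Sum>i\<in>I. \<Sum>j\<in>I. B a i * K i j * cnj (B b j))"
proof -
  have "sform J (\<lambda>a b. \<Sum>i\<in>I. \<Sum>j\<in>I. B a i * K i j * cnj (B b j)) v v
      = sform I K (\<lambda>i. \<Sum>a\<in>J. cnj (B a i) * v a) (\<lambda>i. \<Sum>a\<in>J. cnj (B a i) * v a)" for v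
  proof -
    have "sform J (\<lambda>a b. \<Sum>i\<in>I. \<Sum>j\<in>I. B a i * K i j * cnj (B b j)) v v
        = (\<Sum>a\<in>J. \<Sum>b\<in>J. \<Sum>i\<in>I. \<Sum>j\<in>I. (B a i * cnj (v a)) * K i j * (cnj (B b j) * v b))"
      unfolding sform_def sum_distrib_left sum_distrib_right by (intro sum.cong refl) (simp add: algebra_simps)
    also have "\<dots> = (\<Sum>i\<in>I. \<Sum>a\<in>J. \<Sum>b\<in>J. \<Sum>j\<in>I. (B a i * cnj (v a)) * K i j * (cnj (B b j) * v b))"
      by (rule sum_rotate)
    also have "\<dots> = (\<Sum>i\<in>I. \<Sum>j\<in>I. \<Sum>a\<in>J. \<Sum>b\<in>J. (B a i * cnj (v a)) * K i j * (cnj (B b j) * v b))"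
      by (intro sum.cong refl sum_rotate)
    also have "\<dots> = sform I K (\<lambda>i. \<Sum>a\<in>J. cnj (B a i) * v a) (\<lambda>i. \<Sum>a\<in>J. cnj (B a i) * v a)"
      unfolding sform_def cnj_sum
      by (intro sum.cong refl)
         (simp add: sum_distrib_left sum_distrib_right, subst sum.swap, simp add: algebra_simps)
    finally show ?thesis .
  qed
  then show ?thesis using assms by (simp add: pos_kernel_def)
qed

lemma sum_mult_delta:
  fixes f :: "'a \<Rightarrow> 'b :: semiring_1"
  assumes "finite S" "b \<in> S"
  shows "(\<Sum>j\<in>S. f j * (if j = b then 1 else 0)) = f b"
    and "(\<Sum>j\<in>S. (if j = b then 1 else 0) * f j) = f b"
proof -
  have "(\<lambda>j. f j * (if j = b then 1 else 0)) = (\<lambda>j. if j = b then f j else 0)"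
    "(\<lambda>j. (if j = b then 1 else 0) * f j) = (\<lambda>j. if j = b then f j else 0)" by auto
  with assms show "(\<Sum>j\<in>S. f j * (if j = b then 1 else 0)) = f b"
    and "(\<Sum>j\<in>S. (if j = b then 1 else 0) * f j) = f b" by - (simp_all only: sum.delta' sum.delta if_True)
qed

text \<open>\<open>psd\<close> speaks only of the quadratic form; the entries are recovered by
  evaluating the polarised symmetry on basis vectors.\<close>

lemma psd_hermitian:
  assumes "psd n A"
  shows "cadj A = A"
proof (rule eq_matI)
  from assms have A: "A \<in> carrier_mat n n" and P: "pos_kernel {..<n} (\<lambda>i j. A $$ (i,j))"
    by (auto simp: psd_iff_pos_kernel)
  fix i j assume "i < dim_row A" "j < dim_col A"
  with A have ij: "i < n" "j < n" by auto
  have e: "sform {..<n} (\<lambda>i j. A $$ (i,j)) (\<lambda>x. if x = a then 1 else 0) (\<lambda>x. if x = b then 1 else 0) = A $$ (a,b)"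
    if "a < n" "b < n" for a b
  proof -
    have "cnj (if i = a then 1 else 0) = (if i = a then 1 else 0)" for i by simp
    then show ?thesis
      unfolding sform_def using that by (simp only:) (simp add: sum_mult_delta flip: sum_distrib_left mult.assoc)
  qed
  show "cadj A $$ (i,j) = A $$ (i,j)"
    using pos_kernel_hermitian[OF P, of "\<lambda>x. if x = i then 1 else 0" "\<lambda>x. if x = j then 1 else 0"] A ij
    by (simp add: e)
qed (use assms in \<open>auto simp: psd_def\<close>)

section \<open>Square roots and the trace norm\<close>

definition spec :: "nat \<Rightarrow> complex mat \<Rightarrow> (nat \<Rightarrow> complex) \<Rightarrow> complex mat" where
  "spec n U f = U * dmat n f * cadj U"

lemma spec_carrier [simp]: "U \<in> carrier_mat n n \<Longrightarrow> spec n U f \<in> carrier_mat n n"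
  by (simp add: spec_def)

lemma index_spec:
  assumes "U \<in> carrier_mat n n" "i < n" "j < n"
  shows "spec n U f $$ (i,j) = (\<Sum>k<n. U $$ (i,k) * f k * cnj (U $$ (j,k)))"
  unfolding spec_def using assms
  by (subst index_mult_mat_sum[where n=n and m=n and k=n]) (auto simp: index_mult_dmat intro!: sum.cong)

lemma spec_mult:
  assumes "unitary n U"
  shows "spec n U f * spec n U g = spec n U (\<lambda>i. f i * g i)"
proof -
  note U = unitaryD[OF assms]
  have "spec n U f * spec n U g = U * (dmat n f * ((cadj U * U) * (dmat n g * cadj U)))"
    unfolding spec_def using U(1,2) by (simp add: assoc_mult_mat[of _ n n _ n _ n])
  also have "\<dots> = U * ((dmat n f * dmat n g) * cadj U)"
    unfolding U(3) using U(1,2)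
    by (simp add: assoc_mult_mat[of _ n n _ n _ n] left_mult_one_mat[of _ n n])
  also have "\<dots> = spec n U (\<lambda>i. f i * g i)"
    unfolding dmat_mult spec_def using U(1,2) by (simp add: assoc_mult_mat[of _ n n _ n _ n])
  finally show ?thesis .
qed

lemma cadj_spec: "U \<in> carrier_mat n n \<Longrightarrow> cadj (spec n U f) = spec n U (\<lambda>i. cnj (f i))"
  unfolding spec_def by (simp add: cadj_mult[of _ n n _ n] assoc_mult_mat[of _ n n _ n _ n] cadj_dmat)

lemma mtrace_mult_sum:
  assumes "A \<in> carrier_mat n m" "B \<in> carrier_mat m n"
  shows "mtrace (A * B) = (\<Sum>i<n. \<Sum>j<m. A $$ (i,j) * B $$ (j,i))"
  using assms unfolding mtrace_def by (auto simp: index_mult_mat_sum[OF assms] intro!: sum.cong)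

lemma unitary_col_norm:
  assumes "unitary n U" "k < n"
  shows "(\<Sum>i<n. (cmod (U $$ (i,k)))\<^sup>2) = 1"
proof -
  note U = unitaryD[OF assms(1)]
  have "(\<Sum>i<n. cnj (U $$ (i,k)) * U $$ (i,k)) = 1"
    using index_cadj_mult_sum[OF U(1) U(1) assms(2) assms(2)] U(3) assms(2) by simp
  then show ?thesis unfolding cnj_mult_self by (metis of_real_eq_1_iff of_real_sum)
qed

lemma mtrace_spec:
  assumes "unitary n U"
  shows "mtrace (spec n U f) = (\<Sum>k<n. f k)"
proof -
  note U = unitaryD[OF assms]
  have "mtrace (spec n U f) = (\<Sum>i<n. \<Sum>k<n. U $$ (i,k) * f k * cnj (U $$ (i,k)))"
    using carrier_matD(1)[OF spec_carrier[OF U(1)]] unfolding mtrace_def by (simp add: index_spec[OF U(1)])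
  also have "\<dots> = (\<Sum>k<n. f k * complex_of_real (\<Sum>i<n. (cmod (U $$ (i,k)))\<^sup>2))"
    unfolding of_real_sum cnj_mult_self[symmetric] sum_distrib_left
    by (subst sum.swap, intro sum.cong refl) (simp add: algebra_simps)
  finally show ?thesis by (simp add: unitary_col_norm[OF assms])
qed

lemma psd_spec:
  assumes U: "U \<in> carrier_mat n n" and l: "\<And>k. k < n \<Longrightarrow> l k \<ge> 0"
  shows "psd n (spec n U (\<lambda>k. complex_of_real (l k)))"
proof -
  have "sform {..<n} (\<lambda>i j. spec n U (\<lambda>k. complex_of_real (l k)) $$ (i,j)) v v
      = complex_of_real (\<Sum>k<n. l k * (cmod (\<Sum>j<n. cnj (U $$ (j,k)) * v j))\<^sup>2)" for v
  proof -
    have "sform {..<n} (\<lambda>i j. spec n U (\<lambda>k. complex_of_real (l k)) $$ (i,j)) v v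
        = (\<Sum>i<n. \<Sum>j<n. \<Sum>k<n. cnj (v i) * (U $$ (i,k) * l k * cnj (U $$ (j,k))) * v j)"
      unfolding sform_def by (intro sum.cong refl) (simp add: index_spec[OF U] sum_distrib_left sum_distrib_right)
    also have "\<dots> = (\<Sum>k<n. \<Sum>i<n. \<Sum>j<n. cnj (v i) * (U $$ (i,k) * l k * cnj (U $$ (j,k))) * v j)"
      by (rule sum_rotate)
    also have "\<dots> = (\<Sum>k<n. l k * (cnj (\<Sum>j<n. cnj (U $$ (j,k)) * v j) * (\<Sum>j<n. cnj (U $$ (j,k)) * v j)))"
      unfolding cnj_sum unfolding sum_product unfolding sum_distrib_left by (intro sum.cong refl) (simp add: algebra_simps)
    finally show ?thesis unfolding cnj_mult_self by simp
  qed
  then show ?thesis using U l unfolding psd_iff_pos_kernel pos_kernel_def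
    by (auto intro!: sum_nonneg)
qed

lemma hermitian_spec:
  assumes "A \<in> carrier_mat n n" "cadj A = A"
  obtains U l where "unitary n U" "A = spec n U (\<lambda>k. complex_of_real (l k))"
  using hermitian_spectral[OF assms] unfolding spec_def by blast

text \<open>Column \<open>k\<close> of \<open>U\<close> is a unit eigenvector of
  \<open>spec n U f\<close> with eigenvalue \<open>f k\<close>.\<close>

lemma sform_spec_column:
  assumes U: "unitary n U" and k: "k < n"
  shows "sform {..<n} (\<lambda>i j. spec n U f $$ (i,j)) (\<lambda>i. U $$ (i,k)) (\<lambda>i. U $$ (i,k)) = f k"
proof -
  note Uc = unitaryD[OF U]
  let ?S = "spec n U f"
  have S: "?S \<in> carrier_mat n n" using Uc by simp
  have SU: "?S * U = U * dmat n f"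
    unfolding spec_def using Uc(1,2)
    by (simp add: assoc_mult_mat[of _ n n _ n _ n] Uc(3) right_mult_one_mat[of _ n n])
  have "sform {..<n} (\<lambda>i j. ?S $$ (i,j)) (\<lambda>i. U $$ (i,k)) (\<lambda>i. U $$ (i,k))
      = (\<Sum>i<n. cnj (U $$ (i,k)) * (?S * U) $$ (i,k))"
    unfolding sform_def
    by (intro sum.cong refl, subst index_mult_mat_sum[OF S Uc(1)]) (auto simp: k sum_distrib_left mult.assoc)
  also have "\<dots> = (\<Sum>i<n. cnj (U $$ (i,k)) * U $$ (i,k)) * f k"
    unfolding SU sum_distrib_right by (intro sum.cong refl) (simp add: index_mult_dmat[OF Uc(1)] k)
  also have "\<dots> = f k"
    unfolding cnj_mult_self using unitary_col_norm[OF U k] by (metis mult_1 of_real_1 of_real_sum)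
  finally show ?thesis .
qed

section \<open>Existence and uniqueness of the positive square root\<close>

lemma psd_spec_nonneg:
  assumes U: "unitary n U" and P: "psd n (spec n U (\<lambda>k. complex_of_real (l k)))" and k: "k < n"
  shows "l k \<ge> 0"
  using P sform_spec_column[OF U k, of "\<lambda>k. complex_of_real (l k)"]
  unfolding psd_iff_pos_kernel pos_kernel_def by (metis Re_complex_of_real)

text \<open>\<open>msqrt\<close> is a definite description, so uniqueness is required before it can
  be evaluated. With \<open>P\<close> diagonalised by \<open>V\<close>, the matrix
  \<open>cadj V * U\<close> intertwines the squares of the eigenvalues of \<open>P\<close> with
  \<open>l\<close>; as the eigenvalues are nonnegative it also intertwines the eigenvalues with the
  roots of \<open>l\<close>.\<close>

lemma psd_root_unique:
  assumes U: "unitary n U" and l: "\<And>k. k < n \<Longrightarrow> l k \<ge> 0"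
    and P: "psd n P" and PP: "P * P = spec n U (\<lambda>k. complex_of_real (l k))"
  shows "P = spec n U (\<lambda>k. complex_of_real (sqrt (l k)))"
proof -
  note Uc = unitaryD[OF U]
  from P have Pc: "P \<in> carrier_mat n n" by (simp add: psd_def)
  from hermitian_spec[OF Pc psd_hermitian[OF P]] obtain V p where
    V: "unitary n V" and PV: "P = spec n V (\<lambda>k. complex_of_real (p k))" by blast
  note Vc = unitaryD[OF V]
  have p: "p k \<ge> 0" if "k < n" for k using psd_spec_nonneg[OF V _ that] P PV by simp
  define M where "M = cadj V * U"
  have M: "M \<in> carrier_mat n n" using Uc Vc by (simp add: M_def)
  have VM: "V * M = U" unfolding M_def
    using Uc(1) Vc(1,2) by (simp add: assoc_mult_mat[of _ n n _ n _ n, symmetric] Vc(4) left_mult_one_mat[of _ n n])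
  let ?d = "\<lambda>f. dmat n (\<lambda>k. complex_of_real (f k))"
  have "?d (\<lambda>k. p k * p k) * M = cadj V * (V * ?d (\<lambda>k. p k * p k) * cadj V) * U"
  proof -
    have "cadj V * (V * ?d (\<lambda>k. p k * p k) * cadj V) * U = (cadj V * V) * (?d (\<lambda>k. p k * p k) * (cadj V * U))"
      using Uc(1) Vc(1,2) by (simp add: assoc_mult_mat[of _ n n _ n _ n])
    then show ?thesis using Uc(1) Vc(1,2) by (simp add: Vc(3) M_def left_mult_one_mat[of _ n n])
  qed
  also have "V * ?d (\<lambda>k. p k * p k) * cadj V = spec n U (\<lambda>k. complex_of_real (l k))"
    using PP unfolding PV spec_mult[OF V] by (simp add: spec_def)
  also have "cadj V * spec n U (\<lambda>k. complex_of_real (l k)) * U = M * ?d l * (cadj U * U)"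
    unfolding spec_def M_def using Uc(1,2) Vc(1,2) by (simp add: assoc_mult_mat[of _ n n _ n _ n])
  also have "\<dots> = M * ?d l"
    unfolding Uc(3) using M by (simp add: right_mult_one_mat[of _ n n])
  finally have eq: "?d (\<lambda>k. p k * p k) * M = M * ?d l" .
  have "?d p * M = M * ?d (\<lambda>k. sqrt (l k))"
  proof (rule eq_matI)
    fix i j assume "i < dim_row (M * ?d (\<lambda>k. sqrt (l k)))" "j < dim_col (M * ?d (\<lambda>k. sqrt (l k)))"
    with M have ij: "i < n" "j < n" by auto
    have "complex_of_real (p i * p i) * M $$ (i,j) = M $$ (i,j) * complex_of_real (l j)"
      using arg_cong[OF eq, of "\<lambda>X. X $$ (i,j)"] ij by (simp add: index_dmat_mult[OF M] index_mult_dmat[OF M])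
    \<comment> \<open>A nonzero entry of \<open>M\<close> couples only indices with equal squares,
      and \<open>p i \<ge> 0\<close> then forces \<open>p i = sqrt (l j)\<close>.\<close>
    then have "M $$ (i,j) = 0 \<or> p i * p i = l j"
      by (metis mult.commute mult_cancel_left of_real_eq_iff)
    then have "complex_of_real (p i) * M $$ (i,j) = M $$ (i,j) * complex_of_real (sqrt (l j))"
      using p[OF ij(1)] by (auto simp: real_sqrt_unique power2_eq_square)
    then show "(?d p * M) $$ (i,j) = (M * ?d (\<lambda>k. sqrt (l k))) $$ (i,j)"
      using ij by (simp add: index_dmat_mult[OF M] index_mult_dmat[OF M])
  qed (use M in auto)
  then have eq2: "V * (?d p * M) = V * (M * ?d (\<lambda>k. sqrt (l k)))" by simp
  have "P * U = V * (?d p * M)"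
    unfolding PV spec_def M_def using Uc(1) Vc(1,2) by (simp add: assoc_mult_mat[of _ n n _ n _ n])
  also have "\<dots> = U * ?d (\<lambda>k. sqrt (l k))"
    unfolding eq2 using M Vc(1) by (subst VM[symmetric]) (simp add: assoc_mult_mat[of _ n n _ n _ n])
  finally have PU: "P * U = U * ?d (\<lambda>k. sqrt (l k))" .
  have "P = P * U * cadj U"
    using Pc Uc(1,2) by (simp add: assoc_mult_mat[of _ n n _ n _ n] Uc(4) right_mult_one_mat[of _ n n])
  then show ?thesis unfolding PU spec_def .
qed

lemma msqrt_spec:
  assumes U: "unitary n U" and l: "\<And>k. k < n \<Longrightarrow> l k \<ge> 0"
  shows "msqrt n (spec n U (\<lambda>k. complex_of_real (l k))) = spec n U (\<lambda>k. complex_of_real (sqrt (l k)))"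
  unfolding msqrt_def
proof (rule the_equality)
  let ?R = "spec n U (\<lambda>k. complex_of_real (sqrt (l k)))"
  have "psd n ?R" using unitaryD(1)[OF U] l by (intro psd_spec) auto
  moreover have "?R * ?R = spec n U (\<lambda>k. complex_of_real (l k))"
  proof -
    have "dmat n (\<lambda>k. complex_of_real (sqrt (l k)) * complex_of_real (sqrt (l k))) = dmat n (\<lambda>k. complex_of_real (l k))"
      using l by (intro eq_matI) (auto simp flip: of_real_mult)
    then show ?thesis unfolding spec_mult[OF U] by (simp add: spec_def)
  qed
  ultimately show "psd n ?R \<and> ?R * ?R = spec n U (\<lambda>k. complex_of_real (l k))" by simp
next
  fix P assume "psd n P \<and> P * P = spec n U (\<lambda>k. complex_of_real (l k))"
  then show "P = spec n U (\<lambda>k. complex_of_real (sqrt (l k)))"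
    by (intro psd_root_unique U l) auto
qed

section \<open>The trace norm as a sum of singular values and its variational bounds\<close>

lemma trace_norm_spec:
  assumes U: "unitary n U"
  shows "trace_norm (spec n U (\<lambda>k. complex_of_real (l k))) = (\<Sum>k<n. \<bar>l k\<bar>)"
proof -
  note Uc = unitaryD[OF U]
  have d: "dim_col (spec n U (\<lambda>k. complex_of_real (l k))) = n" using Uc(1) by (simp add: spec_def)
  have "cadj (spec n U (\<lambda>k. complex_of_real (l k))) * spec n U (\<lambda>k. complex_of_real (l k))
      = spec n U (\<lambda>k. complex_of_real (l k * l k))"
    unfolding cadj_spec[OF Uc(1)] spec_mult[OF U] by simp
  then show ?thesis
    unfolding trace_norm_def d by (simp add: msqrt_spec[OF U] mtrace_spec[OF U] del: of_real_mult)
qed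

text \<open>The maximiser is the sign of \<open>H\<close>, which multiplies every eigenvalue to its
  absolute value.\<close>

lemma trace_norm_hermitian_attained:
  assumes "H \<in> carrier_mat n n" "cadj H = H"
  obtains A where "unitary n A" "complex_of_real (trace_norm H) = mtrace (A * H)"
proof -
  from hermitian_spec[OF assms] obtain U l where U: "unitary n U"
    and H: "H = spec n U (\<lambda>k. complex_of_real (l k))" by blast
  note Uc = unitaryD[OF U]
  \<comment> \<open>Zero eigenvalues get sign 1, not \<open>sgn 0 = 0\<close>, so that
    \<open>?A\<close> is unitary.\<close>
  define s where "s = (\<lambda>k. if l k < 0 then - 1 else 1 :: complex)"
  let ?A = "spec n U s"
  have "cadj ?A * ?A = spec n U (\<lambda>_. 1)"
    unfolding cadj_spec[OF Uc(1)] spec_mult[OF U] by (rule arg_cong[of _ _ "spec n U"]) (auto simp: s_def)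
  also have "dmat n (\<lambda>_. 1) = 1\<^sub>m n" by (rule eq_matI) auto
  then have "spec n U (\<lambda>_. 1) = 1\<^sub>m n"
    unfolding spec_def using Uc(1) by (simp add: Uc(4) right_mult_one_mat[of _ n n])
  finally have A: "unitary n ?A" using Uc(1) by (intro unitaryI) auto
  have "mtrace (?A * H) = (\<Sum>k<n. complex_of_real \<bar>l k\<bar>)"
    unfolding H spec_mult[OF U] mtrace_spec[OF U] by (intro sum.cong) (auto simp: s_def)
  then have "complex_of_real (trace_norm H) = mtrace (?A * H)"
    unfolding H trace_norm_spec[OF U] by simp
  with A that show ?thesis by blast
qed

lemma psd_gram:
  assumes Y: "Y \<in> carrier_mat m n"
  shows "psd n (cadj Y * Y)"
proof -
  have "pos_kernel {..<n} (\<lambda>i j. (cadj Y * Y) $$ (i,j)) \<longleftrightarrow>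
        pos_kernel {..<n} (\<lambda>a b. \<Sum>i<m. \<Sum>j<m. cnj (Y $$ (i,a)) * (if i = j then 1 else 0) * cnj (cnj (Y $$ (j,b))))"
    by (rule pos_kernel_cong)
       (simp add: index_cadj_mult_sum[OF Y Y] if_distrib if_distribR sum.delta sum.delta' cong: if_cong)
  moreover have "pos_kernel {..<m} (\<lambda>i j. if i = j then 1 else 0)"
    unfolding pos_kernel_def sform_identity[OF finite_lessThan] cnj_mult_self
    by (auto intro: sum_nonneg)
  ultimately show ?thesis
    using pos_kernel_compress[of "{..<m}" _ "{..<n}" "\<lambda>a i. cnj (Y $$ (i,a))"] Y
    by (simp add: psd_iff_pos_kernel mult_carrier_mat[of _ n m])
qed

text \<open>A singular value argument: expanding \<open>Y\<close> over the eigenbasis of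
  \<open>cadj Y * Y\<close> writes the form as a sum of products of two inner products, which
  Cauchy-Schwarz bounds by the singular value and by 1.\<close>

lemma trace_norm_ge_form:
  assumes Y: "Y \<in> carrier_mat n n" and w: "(\<Sum>i<n. (cmod (w i))\<^sup>2) \<le> 1"
  shows "cmod (sform {..<n} (\<lambda>i j. Y $$ (i,j)) w w) \<le> trace_norm Y"
proof -
  let ?Q = "cadj Y * Y"
  have Q: "psd n ?Q" using psd_gram[OF Y] .
  then have Qc: "?Q \<in> carrier_mat n n" by (simp add: psd_def)
  from hermitian_spec[OF Qc psd_hermitian[OF Q]] obtain U l where U: "unitary n U"
    and QU: "?Q = spec n U (\<lambda>k. complex_of_real (l k))" by blast
  note Uc = unitaryD[OF U]
  have l: "l k \<ge> 0" if "k < n" for k using psd_spec_nonneg[OF U _ that] Q QU by simp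
  have tn: "trace_norm Y = (\<Sum>k<n. sqrt (l k))"
    using Y unfolding trace_norm_def QU by (simp add: msqrt_spec[OF U l] mtrace_spec[OF U])
  \<comment> \<open>The columns of \<open>Z\<close> are orthogonal with squared norms
    \<open>l k\<close>, so \<open>Y = Z * cadj U\<close> is a singular value expansion with the
    singular values absorbed into \<open>Z\<close>.\<close>
  define Z where "Z = Y * U"
  have Z: "Z \<in> carrier_mat n n" using Y Uc by (simp add: Z_def)
  have "cadj Z * Z = cadj U * ?Q * U"
    unfolding Z_def using Y Uc(1,2) by (simp add: cadj_mult[of _ n n _ n] assoc_mult_mat[of _ n n _ n _ n])
  also have "\<dots> = (cadj U * U) * (dmat n (\<lambda>k. complex_of_real (l k)) * (cadj U * U))"
    unfolding QU spec_def using Uc(1,2) by (simp add: assoc_mult_mat[of _ n n _ n _ n])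
  also have "\<dots> = dmat n (\<lambda>k. complex_of_real (l k))"
    unfolding Uc(3) by (simp add: right_mult_one_mat[of _ n n] left_mult_one_mat[of _ n n])
  finally have ZZ: "cadj Z * Z = dmat n (\<lambda>k. complex_of_real (l k))" .
  have Zn: "(\<Sum>i<n. (cmod (Z $$ (i,k)))\<^sup>2) = l k" if k: "k < n" for k
  proof -
    have "complex_of_real (\<Sum>i<n. (cmod (Z $$ (i,k)))\<^sup>2) = complex_of_real (l k)"
      unfolding of_real_sum cnj_mult_self[symmetric]
      using index_cadj_mult_sum[OF Z Z k k] ZZ k by simp
    then show ?thesis by (simp only: of_real_eq_iff)
  qed
  have YZ: "Y = Z * cadj U"
    unfolding Z_def using Y Uc(1,2) by (simp add: assoc_mult_mat[of _ n n _ n _ n] Uc(4) right_mult_one_mat[of _ n n])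
  have Yij: "Y $$ (i,j) = (\<Sum>k<n. Z $$ (i,k) * cnj (U $$ (j,k)))" if "i < n" "j < n" for i j
    using Uc(1,2) that by (subst YZ, subst index_mult_mat_sum[OF Z Uc(2)]) (auto intro!: sum.cong)
  let ?a = "\<lambda>k. \<Sum>i<n. cnj (w i) * Z $$ (i,k)"
  let ?b = "\<lambda>k. \<Sum>j<n. cnj (U $$ (j,k)) * w j"
  have a: "cmod (?a k) \<le> sqrt (l k)" if k: "k < n" for k
  proof (rule real_le_rsqrt)
    have "(cmod (?a k))\<^sup>2 \<le> (\<Sum>i<n. (cmod (w i))\<^sup>2) * l k"
      using complex_Cauchy_Schwarz_sum[of "{..<n}" w "\<lambda>i. Z $$ (i,k)"] by (simp add: Zn[OF k])
    also have "\<dots> \<le> 1 * l k" by (intro mult_right_mono w l k)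
    finally show "(cmod (?a k))\<^sup>2 \<le> l k" by simp
  qed
  have b: "cmod (?b k) \<le> 1" if k: "k < n" for k
  proof -
    have "(cmod (?b k))\<^sup>2 \<le> 1 * (\<Sum>i<n. (cmod (w i))\<^sup>2)"
      using complex_Cauchy_Schwarz_sum[of "{..<n}" "\<lambda>i. U $$ (i,k)" w] by (simp add: unitary_col_norm[OF U k])
    with w have "(cmod (?b k))\<^sup>2 \<le> 1\<^sup>2" by simp
    then show ?thesis by (rule power2_le_imp_le) simp
  qed
  have "sform {..<n} (\<lambda>i j. Y $$ (i,j)) w w
      = (\<Sum>i<n. \<Sum>j<n. \<Sum>k<n. cnj (w i) * (Z $$ (i,k) * cnj (U $$ (j,k))) * w j)"
    unfolding sform_def by (intro sum.cong refl) (simp add: Yij sum_distrib_left sum_distrib_right)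
  also have "\<dots> = (\<Sum>k<n. \<Sum>i<n. \<Sum>j<n. cnj (w i) * (Z $$ (i,k) * cnj (U $$ (j,k))) * w j)"
    by (rule sum_rotate)
  also have "\<dots> = (\<Sum>k<n. ?a k * ?b k)"
    unfolding sum_product by (intro sum.cong refl) (simp add: algebra_simps)
  finally have "cmod (sform {..<n} (\<lambda>i j. Y $$ (i,j)) w w) = cmod (\<Sum>k<n. ?a k * ?b k)" by simp
  also have "\<dots> \<le> (\<Sum>k<n. cmod (?a k) * cmod (?b k))"
    using norm_sum[of "\<lambda>k. ?a k * ?b k" "{..<n}"] by (simp add: norm_mult)
  also have "\<dots> \<le> (\<Sum>k<n. sqrt (l k) * 1)"
    by (intro sum_mono mult_mono) (auto simp: a b l)
  finally show ?thesis by (simp add: tn)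
qed

section \<open>Channels acting on blocks\<close>

lemma mult_add_less_mult:
  assumes "x < n" "a < (k :: nat)"
  shows "x * k + a < n * k"
proof -
  have "x * k + a < Suc x * k" using assms by simp
  also have "\<dots> \<le> n * k" using assms by (intro mult_right_mono) auto
  finally show ?thesis .
qed

lemma bij_betw_div_mod: "bij_betw (\<lambda>u. (u div k, u mod k)) {..<n * k} ({..<n} \<times> {..<k :: nat})"
proof (rule bij_betw_byWitness[where f' = "\<lambda>(x,a). x * k + a"])
  show "(\<lambda>(x,a). x * k + a) ` ({..<n} \<times> {..<k}) \<subseteq> {..<n * k}"
    by (auto simp: mult_add_less_mult)
  show "(\<lambda>u. (u div k, u mod k)) ` {..<n * k} \<subseteq> {..<n} \<times> {..<k}"
  proof safe
    fix u assume u: "u < n * k"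
    then have "k > 0" by (cases "k = 0") auto
    with u show "u div k < n" "u mod k < k" by (auto simp: less_mult_imp_div_less)
  qed
qed auto

text \<open>The second tensor factor is the less significant digit of an index, so fixing its row
  value \<open>a\<close> and column value \<open>b\<close> leaves an operator on the first
  factor.\<close>

definition block :: "nat \<Rightarrow> nat \<Rightarrow> complex mat \<Rightarrow> nat \<Rightarrow> nat \<Rightarrow> complex mat" where
  "block n k X a b = mat n n (\<lambda>(x,y). X $$ (x * k + a, y * k + b))"

lemma block_carrier [simp]: "block n k X a b \<in> carrier_mat n n"
  by (simp add: block_def)

lemma psd_iff_blocks:
  "psd (n * k) X \<longleftrightarrow> X \<in> carrier_mat (n * k) (n * k) \<and>
     pos_kernel ({..<n} \<times> {..<k}) (\<lambda>p q. block n k X (snd p) (snd q) $$ (fst p, fst q))"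
proof -
  have "pos_kernel {..<n * k} (\<lambda>i j. X $$ (i,j)) \<longleftrightarrow>
        pos_kernel {..<n * k} (\<lambda>i j. block n k X (i mod k) (j mod k) $$ (i div k, j div k))"
  proof (rule pos_kernel_cong)
    fix i j assume "i \<in> {..<n * k}" "j \<in> {..<n * k}"
    then have "i div k < n" "j div k < n" by (auto simp: less_mult_imp_div_less)
    then show "X $$ (i,j) = block n k X (i mod k) (j mod k) $$ (i div k, j div k)"
      by (simp add: block_def)
  qed
  also have "\<dots> \<longleftrightarrow> pos_kernel ({..<n} \<times> {..<k}) (\<lambda>p q. block n k X (snd p) (snd q) $$ (fst p, fst q))"
    using pos_kernel_reindex[OF bij_betw_div_mod, of n k "\<lambda>p q. block n k X (snd p) (snd q) $$ (fst p, fst q)"] by simp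
  finally show ?thesis by (simp add: psd_iff_pos_kernel)
qed

lemma index_ext_id:
  "u < m * k \<Longrightarrow> v < m * k \<Longrightarrow>
    ext_id Phi n m k X $$ (u,v) = Phi (block n k X (u mod k) (v mod k)) $$ (u div k, v div k)"
  by (simp add: ext_id_def block_def)

lemma block_ext_id:
  assumes "x < m" "y < m" "a < k" "b < k"
  shows "block m k (ext_id Phi n m k X) a b $$ (x,y) = Phi (block n k X a b) $$ (x,y)"
  using assms by (simp add: block_def[of m] index_ext_id mult_add_less_mult)

text \<open>\<open>Phi\<close> tensored with the identity acts on each block separately.\<close>

lemma psd_ext_id_iff:
  "psd (m * k) (ext_id Phi n m k X) \<longleftrightarrow>
     pos_kernel ({..<m} \<times> {..<k}) (\<lambda>p q. Phi (block n k X (snd p) (snd q)) $$ (fst p, fst q))"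
proof -
  have "pos_kernel ({..<m} \<times> {..<k}) (\<lambda>p q. block m k (ext_id Phi n m k X) (snd p) (snd q) $$ (fst p, fst q)) \<longleftrightarrow>
     pos_kernel ({..<m} \<times> {..<k}) (\<lambda>p q. Phi (block n k X (snd p) (snd q)) $$ (fst p, fst q))"
    by (rule pos_kernel_cong) (auto simp: block_ext_id)
  then show ?thesis unfolding psd_iff_blocks by (simp add: ext_id_def)
qed

section \<open>Complete positivity for general finite ancillas\<close>

lemma cptpD:
  assumes "cptp n m Phi"
  shows "\<And>X. X \<in> carrier_mat n n \<Longrightarrow> Phi X \<in> carrier_mat m m"
    and "\<And>X Y. X \<in> carrier_mat n n \<Longrightarrow> Y \<in> carrier_mat n n \<Longrightarrow> Phi (X + Y) = Phi X + Phi Y"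
    and "\<And>X c. X \<in> carrier_mat n n \<Longrightarrow> Phi (c \<cdot>\<^sub>m X) = c \<cdot>\<^sub>m Phi X"
    and "\<And>X. X \<in> carrier_mat n n \<Longrightarrow> mtrace (Phi X) = mtrace X"
    and "\<And>k X. psd (n * k) X \<Longrightarrow> psd (m * k) (ext_id Phi n m k X)"
  using assms unfolding cptp_def by blast+

text \<open>\<open>cptp\<close> quantifies over ancillas of dimension \<open>k\<close> with numeric
  indices. Enumerating \<open>I\<close> transfers this to any finite index set, in particular to a
  reference coordinate paired with a branch tag.\<close>

lemma cptp_pos_kernel:
  assumes Phi: "cptp n m Phi" and I: "finite I"
    and X: "\<And>\<alpha> \<beta>. \<alpha> \<in> I \<Longrightarrow> \<beta> \<in> I \<Longrightarrow> X \<alpha> \<beta> \<in> carrier_mat n n"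
    and pos: "pos_kernel ({..<n} \<times> I) (\<lambda>p q. X (snd p) (snd q) $$ (fst p, fst q))"
  shows "pos_kernel ({..<m} \<times> I) (\<lambda>p q. Phi (X (snd p) (snd q)) $$ (fst p, fst q))"
proof -
  define k where "k = card I"
  obtain h where h: "bij_betw h {..<k} I"
    using ex_bij_betw_nat_finite[OF I] unfolding k_def atLeast0LessThan by blast
  define M where "M = mat (n * k) (n * k) (\<lambda>(u,v). X (h (u mod k)) (h (v mod k)) $$ (u div k, v div k))"
  have bl: "block n k M a b = X (h a) (h b)" if ab: "a < k" "b < k" for a b
  proof (rule eq_matI)
    have "h a \<in> I" "h b \<in> I" using h ab by (auto simp: bij_betw_def)
    then have Xc: "X (h a) (h b) \<in> carrier_mat n n" by (rule X)
    then show "dim_row (block n k M a b) = dim_row (X (h a) (h b))"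
      "dim_col (block n k M a b) = dim_col (X (h a) (h b))" by (auto simp: block_def)
    fix i j assume "i < dim_row (X (h a) (h b))" "j < dim_col (X (h a) (h b))"
    with Xc have "i < n" "j < n" by auto
    with ab show "block n k M a b $$ (i,j) = X (h a) (h b) $$ (i,j)"
      by (simp add: block_def M_def mult_add_less_mult)
  qed
  have hb: "bij_betw (map_prod id h) ({..<r} \<times> {..<k}) ({..<r} \<times> I)" for r :: nat
    using bij_betw_map_prod[OF _ h, of id "{..<r}" "{..<r}"] by simp
  have "pos_kernel ({..<n} \<times> {..<k}) (\<lambda>p q. block n k M (snd p) (snd q) $$ (fst p, fst q)) \<longleftrightarrow>
      pos_kernel ({..<n} \<times> {..<k}) (\<lambda>p q. X (snd (map_prod id h p)) (snd (map_prod id h q)) $$ (fst (map_prod id h p), fst (map_prod id h q)))"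
    by (rule pos_kernel_cong) (auto simp: bl)
  also have "\<dots> \<longleftrightarrow> pos_kernel ({..<n} \<times> I) (\<lambda>p q. X (snd p) (snd q) $$ (fst p, fst q))"
    by (rule pos_kernel_reindex[OF hb])
  finally have "psd (n * k) M" unfolding psd_iff_blocks using pos by (simp add: M_def)
  from cptpD(5)[OF Phi this]
  have "pos_kernel ({..<m} \<times> {..<k}) (\<lambda>p q. Phi (block n k M (snd p) (snd q)) $$ (fst p, fst q))"
    unfolding psd_ext_id_iff .
  also have "?this \<longleftrightarrow> pos_kernel ({..<m} \<times> {..<k}) (\<lambda>p q. Phi (X (snd (map_prod id h p)) (snd (map_prod id h q))) $$ (fst (map_prod id h p), fst (map_prod id h q)))"
    by (rule pos_kernel_cong) (auto simp: bl)
  also have "\<dots> \<longleftrightarrow> pos_kernel ({..<m} \<times> I) (\<lambda>p q. Phi (X (snd p) (snd q)) $$ (fst p, fst q))"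
    by (rule pos_kernel_reindex[OF hb])
  finally show ?thesis .
qed

text \<open>Complete positivity with a one-point ancilla.\<close>

lemma cptp_psd:
  assumes Phi: "cptp n m Phi" and X: "psd n X"
  shows "psd m (Phi X)"
proof -
  have b: "bij_betw (\<lambda>x. (x, ())) {..<r} ({..<r} \<times> {()})" for r :: nat
    by (auto simp: bij_betw_def inj_on_def)
  have Xc: "X \<in> carrier_mat n n" using X by (simp add: psd_def)
  have "pos_kernel ({..<n} \<times> {()}) (\<lambda>p q. X $$ (fst p, fst q))"
    using X pos_kernel_reindex[OF b, of n "\<lambda>p q. X $$ (fst p, fst q)"] by (simp add: psd_iff_pos_kernel)
  then have "pos_kernel ({..<m} \<times> {()}) (\<lambda>p q. Phi X $$ (fst p, fst q))"
    by (intro cptp_pos_kernel[OF Phi, where X = "\<lambda>_ _. X"] Xc) auto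
  then show ?thesis
    using pos_kernel_reindex[OF b, of m "\<lambda>p q. Phi X $$ (fst p, fst q)"] cptpD(1)[OF Phi Xc]
    by (simp add: psd_iff_pos_kernel)
qed

lemma index_conj:
  assumes "A \<in> carrier_mat m n" "X \<in> carrier_mat n n" "B \<in> carrier_mat m n" "i < m" "j < m"
  shows "(A * X * cadj B) $$ (i,j) = (\<Sum>x<n. \<Sum>y<n. A $$ (i,x) * X $$ (x,y) * cnj (B $$ (j,y)))"
proof -
  have "(A * X * cadj B) $$ (i,j) = (\<Sum>y<n. (\<Sum>x<n. A $$ (i,x) * X $$ (x,y)) * cnj (B $$ (j,y)))"
    using assms by (subst index_mult_mat_sum[where n=m and m=n and k=m])
      (auto simp: index_mult_mat_sum[OF assms(1,2)] intro!: sum.cong)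
  also have "\<dots> = (\<Sum>x<n. \<Sum>y<n. A $$ (i,x) * X $$ (x,y) * cnj (B $$ (j,y)))"
    unfolding sum_distrib_right by (rule sum.swap)
  finally show ?thesis .
qed

text \<open>Congruence by the block diagonal matrix with blocks \<open>A \<alpha>\<close>. Allowing
  the block to vary with the ancilla index makes it possible to tamper in one branch and leave the
  other alone.\<close>

lemma pos_kernel_block_conj:
  fixes X :: "'a \<Rightarrow> 'a \<Rightarrow> complex mat"
  assumes I: "finite I"
    and X: "\<And>\<alpha> \<beta>. \<alpha> \<in> I \<Longrightarrow> \<beta> \<in> I \<Longrightarrow> X \<alpha> \<beta> \<in> carrier_mat n n"
    and A: "\<And>\<alpha>. \<alpha> \<in> I \<Longrightarrow> A \<alpha> \<in> carrier_mat m n"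
    and pos: "pos_kernel ({..<n} \<times> I) (\<lambda>p q. X (snd p) (snd q) $$ (fst p, fst q))"
  shows "pos_kernel ({..<m} \<times> I) (\<lambda>p q. (A (snd p) * X (snd p) (snd q) * cadj (A (snd q))) $$ (fst p, fst q))"
proof -
  \<comment> \<open>The entries of that block diagonal matrix: nonzero only when the ancilla indices
    of row and column agree.\<close>
  let ?B = "\<lambda>p i. A (snd p) $$ (fst p, fst i) * (if snd i = snd p then 1 else 0)"
  have pick: "(\<Sum>i\<in>{..<n} \<times> I. g (fst i) (snd i) * (if snd i = \<alpha> then 1 else 0)) = (\<Sum>x<n. g x \<alpha>)"
    if "\<alpha> \<in> I" for g :: "nat \<Rightarrow> 'a \<Rightarrow> complex" and \<alpha>
  proof -
    have "(\<Sum>i\<in>{..<n} \<times> I. g (fst i) (snd i) * (if snd i = \<alpha> then 1 else 0))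
        = (\<Sum>x<n. \<Sum>\<beta>\<in>I. g x \<beta> * (if \<beta> = \<alpha> then 1 else 0))"
      unfolding sum.cartesian_product by (intro sum.cong) auto
    also have "\<dots> = (\<Sum>x<n. g x \<alpha>)" by (intro sum.cong refl sum_mult_delta I that)
    finally show ?thesis .
  qed
  have "pos_kernel ({..<m} \<times> I) (\<lambda>p q. \<Sum>i\<in>{..<n} \<times> I. \<Sum>j\<in>{..<n} \<times> I.
      ?B p i * X (snd i) (snd j) $$ (fst i, fst j) * cnj (?B q j))"
    by (rule pos_kernel_compress[OF pos])
  also have "?this \<longleftrightarrow> ?thesis"
  proof (rule pos_kernel_cong)
    fix p q assume pq: "p \<in> {..<m} \<times> I" "q \<in> {..<m} \<times> I"
    then have s: "snd p \<in> I" "snd q \<in> I" and f: "fst p < m" "fst q < m" by auto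
    have "(\<Sum>i\<in>{..<n} \<times> I. \<Sum>j\<in>{..<n} \<times> I. ?B p i * X (snd i) (snd j) $$ (fst i, fst j) * cnj (?B q j))
        = (\<Sum>i\<in>{..<n} \<times> I. (\<Sum>j\<in>{..<n} \<times> I. A (snd p) $$ (fst p, fst i) * X (snd i) (snd j) $$ (fst i, fst j) * cnj (A (snd q) $$ (fst q, fst j)) * (if snd j = snd q then 1 else 0)) * (if snd i = snd p then 1 else 0))"
      unfolding sum_distrib_right by (intro sum.cong refl) simp
    also have "\<dots> = (\<Sum>i\<in>{..<n} \<times> I. (\<Sum>y<n. A (snd p) $$ (fst p, fst i) * X (snd i) (snd q) $$ (fst i, y) * cnj (A (snd q) $$ (fst q, y))) * (if snd i = snd p then 1 else 0))"
      by (intro sum.cong refl arg_cong2[where f = "(*)"], rule pick[OF s(2)])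
    also have "\<dots> = (\<Sum>x<n. \<Sum>y<n. A (snd p) $$ (fst p, x) * X (snd p) (snd q) $$ (x, y) * cnj (A (snd q) $$ (fst q, y)))"
      by (rule pick[OF s(1)])
    also have "\<dots> = (A (snd p) * X (snd p) (snd q) * cadj (A (snd q))) $$ (fst p, fst q)"
      by (rule index_conj[symmetric]) (use s f A X in auto)
    finally show "(\<Sum>i\<in>{..<n} \<times> I. \<Sum>j\<in>{..<n} \<times> I. ?B p i * X (snd i) (snd j) $$ (fst i, fst j) * cnj (?B q j))
        = (A (snd p) * X (snd p) (snd q) * cadj (A (snd q))) $$ (fst p, fst q)" .
  qed
  finally show ?thesis .
qed

lemma mtrace_mult_commute:
  assumes "A \<in> carrier_mat n m" "B \<in> carrier_mat m n"
  shows "mtrace (A * B) = mtrace (B * A)"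
  unfolding mtrace_mult_sum[OF assms] mtrace_mult_sum[OF assms(2,1)]
  by (subst sum.swap) (simp add: mult.commute)

text \<open>Unitary conjugations are the only share-wise channels used for tampering.\<close>

lemma cptp_conj:
  assumes "unitary n A"
  shows "cptp n n (\<lambda>X. A * X * cadj A)"
proof -
  note A = unitaryD[OF assms]
  have tr: "mtrace (A * X * cadj A) = mtrace X" if X: "X \<in> carrier_mat n n" for X
  proof -
    have "mtrace (A * X * cadj A) = mtrace (cadj A * (A * X))"
      using A X by (intro mtrace_mult_commute) auto
    also have "cadj A * (A * X) = X"
      using A(1,2) X by (simp add: assoc_mult_mat[of _ n n _ n _ n, symmetric] A(3) left_mult_one_mat[of _ n n])
    finally show ?thesis .
  qed
  have pos: "psd (n * k) (ext_id (\<lambda>X. A * X * cadj A) n n k X)" if X: "psd (n * k) X" for k X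
    unfolding psd_ext_id_iff
    using pos_kernel_block_conj[of "{..<k}" "block n k X" n "\<lambda>_. A" n] X A(1)
    by (simp add: psd_iff_blocks)
  have add: "A * (X + Y) * cadj A = A * X * cadj A + A * Y * cadj A"
    if "X \<in> carrier_mat n n" "Y \<in> carrier_mat n n" for X Y
    using that A(1) mult_add_distrib_mat[OF A(1) that]
      add_mult_distrib_mat[OF square_mult_carrier[OF A(1) that(1)] square_mult_carrier[OF A(1) that(2)] A(2)]
    by simp
  have smult: "A * (c \<cdot>\<^sub>m X) * cadj A = c \<cdot>\<^sub>m (A * X * cadj A)" if "X \<in> carrier_mat n n" for X c
    using mult_smult_distrib[OF A(1) that] mult_smult_assoc_mat[OF square_mult_carrier[OF A(1) that] A(2)]
    by simp
  show ?thesis unfolding cptp_def using A(1) tr pos add smult by auto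
qed

lemma unitary_one: "unitary n (1\<^sub>m n)"
proof -
  have "cadj (1\<^sub>m n) = 1\<^sub>m n" by (rule eq_matI) auto
  then show ?thesis by (simp add: unitary_def)
qed

section \<open>Product unitaries acting on the shares\<close>

definition tensor_mat :: "(nat \<Rightarrow> nat) \<Rightarrow> nat \<Rightarrow> (nat \<Rightarrow> complex mat) \<Rightarrow> complex mat" where
  "tensor_mat d t B = mat (tdim d t) (tdim d t) (\<lambda>(u,x). \<Prod>j<t. B j $$ (digit d t j u, digit d t j x))"

lemma tensor_mat_carrier [simp]: "tensor_mat d t B \<in> carrier_mat (tdim d t) (tdim d t)"
  by (simp add: tensor_mat_def)

lemma digit_less:
  assumes "u < tdim d t" "j < t"
  shows "digit d t j u < d j"
proof -
  have "d j \<noteq> 0"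
  proof
    assume "d j = 0"
    with assms(2) have "tdim d t = 0" unfolding tdim_def by (auto intro: prod_zero)
    with assms(1) show False by simp
  qed
  then show ?thesis by (simp add: digit_def)
qed

lemma index_conj_unitm:
  assumes A: "A \<in> carrier_mat n n" and "r < n" "c < n" "a < n" "b < n"
  shows "(A * unitm n a b * cadj A) $$ (r,c) = A $$ (r,a) * cnj (A $$ (c,b))"
proof -
  have "(A * unitm n a b * cadj A) $$ (r,c) = (\<Sum>x<n. \<Sum>y<n. A $$ (r,x) * unitm n a b $$ (x,y) * cnj (A $$ (c,y)))"
    by (rule index_conj[OF A _ A]) (use assms in \<open>auto simp: unitm_def\<close>)
  also have "\<dots> = (\<Sum>x<n. (\<Sum>y<n. A $$ (r,x) * cnj (A $$ (c,y)) * (if y = b then 1 else 0)) * (if x = a then 1 else 0))"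
    unfolding sum_distrib_right by (intro sum.cong refl) (auto simp: unitm_def)
  also have "\<dots> = A $$ (r,a) * cnj (A $$ (c,b))"
    using assms by (simp only: sum_mult_delta finite_lessThan lessThan_iff)
  finally show ?thesis .
qed

text \<open>\<open>lo_tensor\<close> is fixed by its values on matrix units. A conjugated matrix
  unit has entries that split into a row factor and a conjugated column factor, and the products of
  these over the shares are entries of \<open>tensor_mat\<close>.\<close>

lemma lo_tensor_conj:
  assumes B: "\<And>j. j < t \<Longrightarrow> B j \<in> carrier_mat (d j) (d j)" and X: "X \<in> carrier_mat (tdim d t) (tdim d t)"
  shows "lo_tensor d t (\<lambda>j Z. B j * Z * cadj (B j)) X = tensor_mat d t B * X * cadj (tensor_mat d t B)"
proof (rule eq_matI)
  let ?T = "tensor_mat d t B" and ?N = "tdim d t"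
  fix u v assume "u < dim_row (?T * X * cadj ?T)" "v < dim_col (?T * X * cadj ?T)"
  then have uv: "u < ?N" "v < ?N" by (simp_all add: tensor_mat_def)
  have "lo_tensor d t (\<lambda>j Z. B j * Z * cadj (B j)) X $$ (u,v)
      = (\<Sum>x<?N. \<Sum>y<?N. X $$ (x,y) * (\<Prod>j<t. B j $$ (digit d t j u, digit d t j x) * cnj (B j $$ (digit d t j v, digit d t j y))))"
    using uv unfolding lo_tensor_def
    by (auto intro!: sum.cong prod.cong simp: index_conj_unitm[OF B] digit_less)
  also have "\<dots> = (\<Sum>x<?N. \<Sum>y<?N. ?T $$ (u,x) * X $$ (x,y) * cnj (?T $$ (v,y)))"
    using uv by (intro sum.cong refl) (simp add: tensor_mat_def prod.distrib algebra_simps)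
  also have "\<dots> = (?T * X * cadj ?T) $$ (u,v)"
    using uv by (intro index_conj[symmetric] X) auto
  finally show "lo_tensor d t (\<lambda>j Z. B j * Z * cadj (B j)) X $$ (u,v) = (?T * X * cadj ?T) $$ (u,v)" .
qed (simp_all add: lo_tensor_def tensor_mat_def)

text \<open>Duality between acting on share \<open>i\<close> alone and tracing out all the others;
  it turns a statement about a marginal into one about the whole codeword.\<close>

lemma mtrace_tensor_mat_single:
  assumes i: "i < t" and A: "A \<in> carrier_mat (d i) (d i)" and X: "X \<in> carrier_mat (tdim d t) (tdim d t)"
  shows "mtrace (tensor_mat d t (\<lambda>j. if j = i then A else 1\<^sub>m (d j)) * X) = mtrace (A * ptr_keep d t i X)"
proof -
  let ?N = "tdim d t" and ?D = "digit d t"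
  let ?E = "\<lambda>x y. \<forall>j<t. j \<noteq> i \<longrightarrow> ?D j x = ?D j y"
  let ?T = "tensor_mat d t (\<lambda>j. if j = i then A else 1\<^sub>m (d j))"
  \<comment> \<open>The identity factors contribute 1 exactly when all other digits agree, which is
    the condition inside \<open>ptr_keep\<close>.\<close>
  have T: "?T $$ (y,x) = (if ?E x y then A $$ (?D i y, ?D i x) else 0)" if xy: "x < ?N" "y < ?N" for x y
  proof -
    have "?T $$ (y,x) = A $$ (?D i y, ?D i x) * (\<Prod>j\<in>{..<t} - {i}. 1\<^sub>m (d j) $$ (?D j y, ?D j x))"
      using xy i by (auto simp: tensor_mat_def prod.remove[of "{..<t}" i] intro!: prod.cong)
    also have "(\<Prod>j\<in>{..<t} - {i}. 1\<^sub>m (d j) $$ (?D j y, ?D j x)) = (\<Prod>j\<in>{..<t} - {i}. if ?D j x = ?D j y then 1 else 0 :: complex)"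
      using xy by (intro prod.cong refl) (auto simp: digit_less)
    also have "\<dots> = (if ?E x y then 1 else 0)"
    proof (cases "?E x y")
      case True
      then show ?thesis by (intro trans[OF prod.neutral]) auto
    next
      case False
      then obtain j where "j < t" "j \<noteq> i" "?D j x \<noteq> ?D j y" by blast
      then show ?thesis using False by (intro trans[OF prod_zero]) auto
    qed
    finally show ?thesis by (simp only: if_distrib[of "(*) _"] mult_1_right mult_zero_right)
  qed
  have move_if: "(if b then a else 0) * x = a * (if b then x else 0)" for a x :: complex and b by simp
  have K: "ptr_keep d t i X \<in> carrier_mat (d i) (d i)" by (simp add: ptr_keep_def)
  have "mtrace (A * ptr_keep d t i X)
      = (\<Sum>a<d i. \<Sum>b<d i. \<Sum>x<?N. \<Sum>y<?N. A $$ (a,b) * (if ?D i x = b \<and> ?D i y = a \<and> ?E x y then X $$ (x,y) else 0))"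
    unfolding mtrace_mult_sum[OF A K]
    by (intro sum.cong refl) (simp add: ptr_keep_def sum_distrib_left)
  also have "\<dots> = (\<Sum>a<d i. \<Sum>x<?N. \<Sum>y<?N. \<Sum>b<d i. A $$ (a,b) * (if ?D i x = b \<and> ?D i y = a \<and> ?E x y then X $$ (x,y) else 0))"
    by (intro sum.cong refl sum_rotate[symmetric])
  also have "\<dots> = (\<Sum>x<?N. \<Sum>y<?N. \<Sum>a<d i. \<Sum>b<d i. A $$ (a,b) * (if ?D i x = b \<and> ?D i y = a \<and> ?E x y then X $$ (x,y) else 0))"
    by (rule sum_rotate[symmetric])
  also have "\<dots> = (\<Sum>x<?N. \<Sum>y<?N. ?T $$ (y,x) * X $$ (x,y))"
  proof (intro sum.cong refl)
    fix x y assume "x \<in> {..<?N}" "y \<in> {..<?N}"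
    then have xy: "x < ?N" "y < ?N" by auto
    have "(\<Sum>a<d i. \<Sum>b<d i. A $$ (a,b) * (if ?D i x = b \<and> ?D i y = a \<and> ?E x y then X $$ (x,y) else 0))
      = (\<Sum>a<d i. (\<Sum>b<d i. A $$ (a,b) * (if ?E x y then X $$ (x,y) else 0) * (if b = ?D i x then 1 else 0)) * (if a = ?D i y then 1 else 0))"
      unfolding sum_distrib_right by (intro sum.cong refl) auto
    also have "\<dots> = A $$ (?D i y, ?D i x) * (if ?E x y then X $$ (x,y) else 0)"
      using digit_less[OF xy(1) i] digit_less[OF xy(2) i]
      by (simp only: sum_mult_delta finite_lessThan lessThan_iff)
    finally show "(\<Sum>a<d i. \<Sum>b<d i. A $$ (a,b) * (if ?D i x = b \<and> ?D i y = a \<and> ?E x y then X $$ (x,y) else 0)) = ?T $$ (y,x) * X $$ (x,y)"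
      by (simp only: T[OF xy] move_if)
  qed
  also have "\<dots> = mtrace (?T * X)"
    unfolding mtrace_mult_sum[OF tensor_mat_carrier X] by (rule sum.swap)
  finally show ?thesis by simp
qed

section \<open>Tamper detection implies encryption of single shares\<close>

text \<open>The tag divides the kernel into a two by two array of blocks, and vectors supported on
  one tag each read off a single block.\<close>

lemma sform_tag:
  assumes "finite J"
  shows "sform (J \<times> UNIV) \<Theta> (\<lambda>p. if snd p = s then v (fst p) else 0) (\<lambda>p. if snd p = s' then w (fst p) else 0)
    = sform J (\<lambda>p q. \<Theta> (p, s :: bool) (q, s')) v w"
proof -
  have tag: "(\<Sum>p\<in>J \<times> UNIV. (if snd p = r then g p else 0)) = (\<Sum>p\<in>J. g (p, r))" for g :: "_ \<Rightarrow> complex" and r :: bool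
  proof -
    have "(\<Sum>p\<in>J \<times> UNIV. (if snd p = r then g p else 0)) = (\<Sum>x\<in>J. \<Sum>b\<in>UNIV. if b = r then g (x, b) else 0)"
      unfolding sum.cartesian_product by (intro sum.cong) auto
    then show ?thesis by (simp add: sum.delta)
  qed
  have "sform (J \<times> UNIV) \<Theta> (\<lambda>p. if snd p = s then v (fst p) else 0) (\<lambda>p. if snd p = s' then w (fst p) else 0)
    = (\<Sum>p\<in>J \<times> UNIV. if snd p = s then (\<Sum>q\<in>J \<times> UNIV. if snd q = s' then cnj (v (fst p)) * \<Theta> (fst p, s) (fst q, s') * w (fst q) else 0) else 0)"
    unfolding sform_def by (intro sum.cong refl) (auto intro!: sum.cong)
  also have "\<dots> = sform J (\<lambda>p q. \<Theta> (p, s) (q, s')) v w"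
    unfolding tag sform_def by simp
  finally show ?thesis .
qed

text \<open>If the lower right block of a positive \<open>2 \<times> 2\<close> block kernel is the projection onto a unit
  vector \<open>w\<close>, then the off-diagonal block annihilates the complement of \<open>w\<close>, so its trace is
  its matrix element at \<open>w\<close>.\<close>
lemma pos_kernel_offdiag_trace:
  assumes J: "finite J" and pos: "pos_kernel (J \<times> UNIV) \<Theta>"
    and one: "\<And>p q. p \<in> J \<Longrightarrow> q \<in> J \<Longrightarrow> \<Theta> (p, True) (q, True) = w p * cnj (w q)"
    and w: "(\<Sum>p\<in>J. (cmod (w p))\<^sup>2) = 1"
  shows "(cmod (\<Sum>p\<in>J. \<Theta> (p, False) (p, True)))\<^sup>2
    \<le> Re (sform J (\<lambda>p q. \<Theta> (p, False) (q, False)) w w)"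
proof -
  let ?c = "\<lambda>s s' p q. \<Theta> (p, s :: bool) (q, s' :: bool)"
  have CS: "(cmod (sform J (?c False True) v u))\<^sup>2
      \<le> Re (sform J (?c False False) v v) * Re (sform J (?c True True) u u)" for v u
    using pos_kernel_Cauchy_Schwarz[OF pos, of "\<lambda>p. if snd p = False then v (fst p) else 0" "\<lambda>p. if snd p = True then u (fst p) else 0"]
    unfolding sform_tag[OF J] .
  have diag: "sform J (?c True True) u u = complex_of_real ((cmod (\<Sum>p\<in>J. cnj (w p) * u p))\<^sup>2)" for u
  proof -
    have "sform J (?c True True) u u = (\<Sum>p\<in>J. \<Sum>q\<in>J. (w p * cnj (u p)) * (cnj (w q) * u q))"
      unfolding sform_def by (intro sum.cong refl) (simp add: one algebra_simps)
    then show ?thesis unfolding cnj_mult_self[symmetric] cnj_sum unfolding sum_product by simp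
  qed
  have w1: "(\<Sum>p\<in>J. cnj (w p) * w p) = 1"
    unfolding cnj_mult_self using w by (metis of_real_1 of_real_sum)
  \<comment> \<open>The vector \<open>?u\<close> is the basis vector at \<open>q\<close> minus its
    projection onto \<open>w\<close>. The lower right form vanishes at \<open>?u\<close>, so
    Cauchy-Schwarz makes the off-diagonal block vanish there too.\<close>
  have off: "\<Theta> (p, False) (q, True) = (\<Sum>q'\<in>J. \<Theta> (p, False) (q', True) * w q') * cnj (w q)"
    if p: "p \<in> J" and q: "q \<in> J" for p q
  proof -
    let ?e = "\<lambda>x. if x = p then 1 else 0 :: complex"
    let ?u = "\<lambda>x. (if x = q then 1 else 0) - w x * cnj (w q)"
    have "(\<Sum>x\<in>J. cnj (w x) * ?u x) = (\<Sum>x\<in>J. cnj (w x) * (if x = q then 1 else 0)) - (\<Sum>x\<in>J. cnj (w x) * w x) * cnj (w q)"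
      unfolding sum_distrib_right sum_subtractf[symmetric] by (intro sum.cong refl) (simp add: algebra_simps)
    then have "(\<Sum>x\<in>J. cnj (w x) * ?u x) = 0"
      unfolding w1 sum_mult_delta[OF J q] by simp
    then have "sform J (?c False True) ?e ?u = 0"
      using CS[of ?e ?u] unfolding diag by simp
    moreover have "sform J (?c False True) ?e ?u = (\<Sum>x\<in>J. \<Theta> (p, False) (x, True) * ?u x)"
    proof -
      have "sform J (?c False True) ?e ?u = (\<Sum>y\<in>J. (if y = p then 1 else 0) * (\<Sum>x\<in>J. \<Theta> (y, False) (x, True) * ?u x))"
        unfolding sform_def sum_distrib_left by (intro sum.cong refl) simp
      then show ?thesis unfolding sum_mult_delta[OF J p] .
    qed
    moreover have "(\<Sum>x\<in>J. \<Theta> (p, False) (x, True) * ?u x)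
        = (\<Sum>x\<in>J. \<Theta> (p, False) (x, True) * (if x = q then 1 else 0)) - (\<Sum>x\<in>J. \<Theta> (p, False) (x, True) * w x) * cnj (w q)"
      unfolding sum_distrib_right sum_subtractf[symmetric] by (intro sum.cong refl) (simp add: algebra_simps)
    ultimately show ?thesis unfolding sum_mult_delta[OF J q] by simp
  qed
  have "(\<Sum>p\<in>J. \<Theta> (p, False) (p, True)) = (\<Sum>p\<in>J. (\<Sum>q\<in>J. \<Theta> (p, False) (q, True) * w q) * cnj (w p))"
    by (intro sum.cong refl off)
  also have "\<dots> = sform J (?c False True) w w"
    unfolding sform_def sum_distrib_right by (intro sum.cong refl) (simp add: algebra_simps)
  finally have "(cmod (\<Sum>p\<in>J. \<Theta> (p, False) (p, True)))\<^sup>2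
      \<le> Re (sform J (?c False False) w w) * Re (sform J (?c True True) w w)" using CS[of w w] by simp
  also have "Re (sform J (?c True True) w w) = 1" unfolding diag w1 by simp
  finally show ?thesis by simp
qed

text \<open>Matrices are read as vectors with amplitude \<open>P $$ (x,a)\<close> at system
  coordinate \<open>x\<close> and reference coordinate \<open>a\<close>; this is the block at
  reference indices \<open>a\<close>, \<open>b\<close> of the rank one operator formed from the
  vectors \<open>P\<close> and \<open>F\<close>.\<close>

definition outer_block :: "nat \<Rightarrow> complex mat \<Rightarrow> complex mat \<Rightarrow> nat \<Rightarrow> nat \<Rightarrow> complex mat" where
  "outer_block n P F a b = mat n n (\<lambda>(x,y). P $$ (x,a) * cnj (F $$ (y,b)))"

lemma outer_block_carrier [simp]: "outer_block n P F a b \<in> carrier_mat n n"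
  by (simp add: outer_block_def)

lemma cptp_zero:
  assumes "cptp n m Phi"
  shows "Phi (0\<^sub>m n n) = 0\<^sub>m m m"
proof -
  have "Phi (0 \<cdot>\<^sub>m 0\<^sub>m n n) = 0 \<cdot>\<^sub>m Phi (0\<^sub>m n n)" by (rule cptpD(3)[OF assms]) simp
  moreover have "0 \<cdot>\<^sub>m 0\<^sub>m n n = (0\<^sub>m n n :: complex mat)" by (rule eq_matI) auto
  moreover have "0 \<cdot>\<^sub>m Phi (0\<^sub>m n n) = 0\<^sub>m m m" using cptpD(1)[OF assms, of "0\<^sub>m n n"] by (intro eq_matI) auto
  ultimately show ?thesis by simp
qed

lemma mtrace_add: "A \<in> carrier_mat n n \<Longrightarrow> B \<in> carrier_mat n n \<Longrightarrow> mtrace (A + B) = mtrace A + mtrace B"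
  by (simp add: mtrace_def sum.distrib)

lemma mtrace_smult: "A \<in> carrier_mat n n \<Longrightarrow> mtrace (c \<cdot>\<^sub>m A) = c * mtrace A"
  by (simp add: mtrace_def sum_distrib_left)

text \<open>\<open>P * cadj F\<close> is the partial trace over the reference, hence the sum of the
  diagonal blocks. Only binary additivity of \<open>Phi\<close> is at hand, so the sum is built by
  induction.\<close>

lemma mtrace_mult_cptp_sum:
  assumes Phi: "cptp n m Phi" and T: "T \<in> carrier_mat m m"
    and P: "P \<in> carrier_mat n k" and F: "F \<in> carrier_mat n k"
  shows "mtrace (T * Phi (P * cadj F)) = (\<Sum>a<k. mtrace (T * Phi (outer_block n P F a a)))"
proof -
  define M where "M = (\<lambda>r. mat n n (\<lambda>(x,y). \<Sum>a<r. P $$ (x,a) * cnj (F $$ (y,a))))"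
  have Mc: "M r \<in> carrier_mat n n" for r by (simp add: M_def)
  note Phi' = cptpD[OF Phi]
  have "mtrace (T * Phi (M r)) = (\<Sum>a<r. mtrace (T * Phi (outer_block n P F a a)))" for r
  proof (induction r)
    case 0
    have "M 0 = 0\<^sub>m n n" by (rule eq_matI) (auto simp: M_def)
    then show ?case using T by (simp add: cptp_zero[OF Phi] right_mult_zero_mat[of T m m] mtrace_def)
  next
    case (Suc r)
    have "M (Suc r) = M r + outer_block n P F r r"
      by (rule eq_matI) (auto simp: M_def outer_block_def)
    then have "T * Phi (M (Suc r)) = T * Phi (M r) + T * Phi (outer_block n P F r r)"
      using Mc mult_add_distrib_mat[OF T Phi'(1)[OF Mc] Phi'(1)[OF outer_block_carrier]] by (simp add: Phi'(2))
    then show ?case using T Mc Phi'(1) Suc.IH by (simp add: mtrace_add[of _ m])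
  qed
  moreover have "M k = P * cadj F"
    using P F by (intro eq_matI) (auto simp: M_def index_mult_mat_sum[where n=n and m=k and k=n] intro!: sum.cong)
  ultimately show ?thesis by metis
qed

text \<open>The blocks of the code applied to the projection onto \<open>P \<otimes> e\<^sub>0 + F \<otimes> e\<^sub>1\<close>, with the
  tampering \<open>T\<close> acting only on the first branch: the second branch decodes to the pure state \<open>F\<close>.\<close>
lemma tampered_overlap:
  assumes Enc: "cptp n m Enc" and Dec: "cptp m (Suc n) Dec"
    and id: "\<And>\<rho>. \<rho> \<in> carrier_mat n n \<Longrightarrow> Dec (Enc \<rho>) = pad (Suc n) \<rho>"
    and T: "T \<in> carrier_mat m m" and P: "P \<in> carrier_mat n n" and F: "F \<in> carrier_mat n n"
    and F1: "(\<Sum>x<n. \<Sum>a<n. (cmod (F $$ (x,a)))\<^sup>2) = 1"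
  defines "w \<equiv> \<lambda>p. if fst p < n then F $$ p else 0"
  shows "(cmod (mtrace (T * Enc (P * cadj F))))\<^sup>2
    \<le> Re (sform ({..<Suc n} \<times> {..<n})
        (\<lambda>p q. Dec (T * Enc (outer_block n P P (snd p) (snd q)) * cadj T) $$ (fst p, fst q)) w w)"
proof -
  \<comment> \<open>An ancilla index is a reference coordinate with a branch tag:
    \<open>False\<close> carries \<open>P\<close> and is tampered with, \<open>True\<close> carries
    \<open>F\<close> and is not.\<close>
  let ?I = "{..<n} \<times> (UNIV :: bool set)"
  let ?\<phi> = "\<lambda>s. if s then F else P"
  let ?A = "\<lambda>\<alpha> :: nat \<times> bool. if snd \<alpha> then 1\<^sub>m m else T"
  define R where "R = (\<lambda>\<alpha> \<beta> :: nat \<times> bool. outer_block n (?\<phi> (snd \<alpha>)) (?\<phi> (snd \<beta>)) (fst \<alpha>) (fst \<beta>))"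
  define S where "S = (\<lambda>\<alpha> \<beta>. ?A \<alpha> * Enc (R \<alpha> \<beta>) * cadj (?A \<beta>))"
  have Rc: "R \<alpha> \<beta> \<in> carrier_mat n n" for \<alpha> \<beta> by (simp add: R_def)
  have Ec: "Enc (R \<alpha> \<beta>) \<in> carrier_mat m m" for \<alpha> \<beta> using cptpD(1)[OF Enc Rc] .
  have Ac: "?A \<alpha> \<in> carrier_mat m m" for \<alpha> using T by simp
  have Sc: "S \<alpha> \<beta> \<in> carrier_mat m m" for \<alpha> \<beta>
    unfolding S_def using Ac Ec by (intro mult_carrier_mat[of _ m m] cadj_carrier) auto
  have "pos_kernel ({..<n} \<times> ?I) (\<lambda>p q. R (snd p) (snd q) $$ (fst p, fst q))"
    using pos_kernel_rank_one[of "{..<n} \<times> ?I" "\<lambda>p. ?\<phi> (snd (snd p)) $$ (fst p, fst (snd p))"]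
    by (rule iffD1[OF pos_kernel_cong, rotated]) (auto simp: R_def outer_block_def)
  then have "pos_kernel ({..<m} \<times> ?I) (\<lambda>p q. Enc (R (snd p) (snd q)) $$ (fst p, fst q))"
    by (intro cptp_pos_kernel[OF Enc] Rc) auto
  then have "pos_kernel ({..<m} \<times> ?I) (\<lambda>p q. S (snd p) (snd q) $$ (fst p, fst q))"
    unfolding S_def by (intro pos_kernel_block_conj) (auto simp: Ec T)
  then have pos: "pos_kernel ({..<Suc n} \<times> ?I) (\<lambda>p q. Dec (S (snd p) (snd q)) $$ (fst p, fst q))"
    by (intro cptp_pos_kernel[OF Dec] Sc) auto
  let ?J = "{..<Suc n} \<times> {..<n}"
  \<comment> \<open>Regrouping moves the tag outermost, the shape that
    \<open>pos_kernel_offdiag_trace\<close> expects.\<close>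
  let ?h = "\<lambda>p :: (nat \<times> nat) \<times> bool. (fst (fst p), (snd (fst p), snd p))"
  define \<Theta> where "\<Theta> = (\<lambda>p q. Dec (S (snd (?h p)) (snd (?h q))) $$ (fst (?h p), fst (?h q)))"
  have h: "bij_betw ?h (?J \<times> UNIV) ({..<Suc n} \<times> ?I)"
    by (rule bij_betw_byWitness[where f' = "\<lambda>p. ((fst p, fst (snd p)), snd (snd p))"]) auto
  have pos\<Theta>: "pos_kernel (?J \<times> UNIV) \<Theta>"
    unfolding \<Theta>_def using pos_kernel_reindex[OF h, of "\<lambda>p q. Dec (S (snd p) (snd q)) $$ (fst p, fst q)"] pos by simp
  have c1: "cadj (1\<^sub>m m) = 1\<^sub>m m" by (rule eq_matI) auto
  have S11: "S (a, True) (b, True) = Enc (R (a, True) (b, True))" for a b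
    unfolding S_def using Ec[of "(a,True)" "(b,True)"] by (simp add: c1)
  have S01: "S (a, False) (b, True) = T * Enc (R (a, False) (b, True))" for a b
    unfolding S_def using Ec[of "(a,False)" "(b,True)"] T by (simp add: c1)
  have one: "\<Theta> (p, True) (q, True) = w p * cnj (w q)" if "p \<in> ?J" "q \<in> ?J" for p q
    using that unfolding \<Theta>_def w_def
    by (auto simp: S11 id Rc pad_def R_def outer_block_def)
  have w1: "(\<Sum>p\<in>?J. (cmod (w p))\<^sup>2) = 1"
  proof -
    have "(\<Sum>p\<in>?J. (cmod (w p))\<^sup>2) = (\<Sum>x<Suc n. \<Sum>a<n. (cmod (w (x,a)))\<^sup>2)"
      unfolding sum.cartesian_product by (intro sum.cong) auto
    also have "\<dots> = (\<Sum>x<n. \<Sum>a<n. (cmod (F $$ (x,a)))\<^sup>2)"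
      by (simp add: w_def)
    finally show ?thesis using F1 by simp
  qed
  have "(\<Sum>p\<in>?J. \<Theta> (p, False) (p, True)) = (\<Sum>x<Suc n. \<Sum>a<n. \<Theta> ((x,a), False) ((x,a), True))"
    unfolding sum.cartesian_product by (intro sum.cong) auto
  also have "\<dots> = (\<Sum>a<n. \<Sum>x<Suc n. Dec (T * Enc (outer_block n P F a a)) $$ (x,x))"
    by (subst sum.swap) (simp add: \<Theta>_def S01 R_def)
  \<comment> \<open>\<open>Dec\<close> preserves the trace, so it drops out of the off-diagonal
    trace.\<close>
  also have "\<dots> = (\<Sum>a<n. mtrace (T * Enc (outer_block n P F a a)))"
  proof (intro sum.cong refl)
    fix a
    have TE: "T * Enc (outer_block n P F a a) \<in> carrier_mat m m"
      using T cptpD(1)[OF Enc] by simp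
    show "(\<Sum>x<Suc n. Dec (T * Enc (outer_block n P F a a)) $$ (x,x)) = mtrace (T * Enc (outer_block n P F a a))"
      using cptpD(4)[OF Dec TE] cptpD(1)[OF Dec TE] unfolding mtrace_def[of "Dec _"] by simp
  qed
  also have "\<dots> = mtrace (T * Enc (P * cadj F))"
    by (rule mtrace_mult_cptp_sum[OF Enc T P F, symmetric])
  finally have tr: "(\<Sum>p\<in>?J. \<Theta> (p, False) (p, True)) = mtrace (T * Enc (P * cadj F))" .
  have S00: "\<Theta> (p, False) (q, False) = Dec (T * Enc (outer_block n P P (snd p) (snd q)) * cadj T) $$ (fst p, fst q)" for p q
    by (simp add: \<Theta>_def S_def R_def)
  show ?thesis
    using pos_kernel_offdiag_trace[OF _ pos\<Theta> one w1] unfolding tr S00 by simp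
qed

section \<open>The security condition tested on a vector orthogonal to the message\<close>

lemma sform_diff: "sform I (\<lambda>i j. K i j - L i j) v w = sform I K v w - sform I L v w"
  unfolding sform_def by (simp add: algebra_simps sum_subtractf)

text \<open>Both terms of the ideal outcome vanish on \<open>w\<close>: the padded purification is
  the rank one projector of \<open>P\<close>, which is orthogonal to \<open>F\<close>, and the
  rejection term lives at first coordinate \<open>n\<close>, where \<open>w\<close> is zero.\<close>

lemma tampered_canon_pur_form:
  fixes F :: "complex mat"
  assumes P: "P = msqrt n \<sigma>" and F: "F \<in> carrier_mat n n"
    and orth: "(\<Sum>x<n. \<Sum>a<n. cnj (F $$ (x,a)) * P $$ (x,a)) = 0"
  defines "w \<equiv> \<lambda>p. if fst p < n then F $$ p else 0"
  shows "sform {..<Suc n * n} (\<lambda>u v. (ext_id Phi n (Suc n) n (canon_pur n \<sigma>)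
        - (c \<cdot>\<^sub>m pad (Suc n * n) (canon_pur n \<sigma>) + e \<cdot>\<^sub>m kron (botm n) (ptr_first n n (canon_pur n \<sigma>)))) $$ (u,v))
        (\<lambda>u. w (u div n, u mod n)) (\<lambda>u. w (u div n, u mod n))
     = sform ({..<Suc n} \<times> {..<n}) (\<lambda>p q. Phi (outer_block n P P (snd p) (snd q)) $$ (fst p, fst q)) w w"
proof -
  let ?S = "canon_pur n \<sigma>" and ?J = "{..<Suc n} \<times> {..<n}"
  let ?w = "\<lambda>u. w (u div n, u mod n)"
  have dm: "u div n < Suc n" "u mod n < n" if "u < Suc n * n" for u
    using bij_betwE[OF bij_betw_div_mod[of n "Suc n"]] that by auto
  have dims: "dim_row ?S = n * n" "dim_col ?S = n * n" by (simp_all add: canon_pur_def Let_def)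
  have Sij: "?S $$ (u,v) = P $$ (u div n, u mod n) * cnj (P $$ (v div n, v mod n))" if "u < n * n" "v < n * n" for u v
    using that P by (simp add: canon_pur_def Let_def)
  have bl: "block n n ?S a b = outer_block n P P a b" if "a < n" "b < n" for a b
    using that by (intro eq_matI) (auto simp: block_def outer_block_def Sij mult_add_less_mult)
  let ?g = "\<lambda>u. if u < n * n then P $$ (u div n, u mod n) else 0"
  have kr: "kron (botm n) (ptr_first n n ?S) \<in> carrier_mat (Suc n * n) (Suc n * n)"
    by (simp add: kron_def botm_def ptr_first_def)
  have w0: "w (n, a) = 0" for a by (simp add: w_def)
  have "sform {..<Suc n * n} (\<lambda>u v. (ext_id Phi n (Suc n) n ?S
        - (c \<cdot>\<^sub>m pad (Suc n * n) ?S + e \<cdot>\<^sub>m kron (botm n) (ptr_first n n ?S))) $$ (u,v)) ?w ?w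
      = sform {..<Suc n * n} (\<lambda>u v. Phi (outer_block n P P (u mod n) (v mod n)) $$ (u div n, v div n)
          - c * (?g u * cnj (?g v))) ?w ?w"
    unfolding sform_def
  proof (intro sum.cong refl)
    fix u v assume "u \<in> {..<Suc n * n}" "v \<in> {..<Suc n * n}"
    then have uv: "u < Suc n * n" "v < Suc n * n" by auto
    \<comment> \<open>The rejection term can be nonzero only in rows with first coordinate
      \<open>n\<close>; there \<open>w0\<close> kills the summand.\<close>
    have k: "kron (botm n) (ptr_first n n ?S) $$ (u,v) = 0" if "u div n \<noteq> n"
      using uv dm[OF uv(1)] dm[OF uv(2)] that by (simp add: kron_def botm_def ptr_first_def)
    have pd: "pad (Suc n * n) ?S $$ (u,v) = ?g u * cnj (?g v)"
      using uv by (simp add: pad_def dims Sij)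
    have ex: "ext_id Phi n (Suc n) n ?S $$ (u,v) = Phi (outer_block n P P (u mod n) (v mod n)) $$ (u div n, v div n)"
      using index_ext_id[OF uv] dm[OF uv(1)] dm[OF uv(2)] by (simp add: bl)
    have "pad (Suc n * n) ?S \<in> carrier_mat (Suc n * n) (Suc n * n)" by (simp add: pad_def)
    then have "(ext_id Phi n (Suc n) n ?S - (c \<cdot>\<^sub>m pad (Suc n * n) ?S + e \<cdot>\<^sub>m kron (botm n) (ptr_first n n ?S))) $$ (u,v)
       = ext_id Phi n (Suc n) n ?S $$ (u,v) - (c * pad (Suc n * n) ?S $$ (u,v) + e * kron (botm n) (ptr_first n n ?S) $$ (u,v))"
      using uv kr by (simp del: mult_Suc)
    then show "cnj (?w u) * (ext_id Phi n (Suc n) n ?S - (c \<cdot>\<^sub>m pad (Suc n * n) ?S + e \<cdot>\<^sub>m kron (botm n) (ptr_first n n ?S))) $$ (u,v) * ?w v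
      = cnj (?w u) * (Phi (outer_block n P P (u mod n) (v mod n)) $$ (u div n, v div n) - c * (?g u * cnj (?g v))) * ?w v"
      unfolding pd ex using k by (cases "u div n = n") (simp_all add: w0)
  qed
  also have "\<dots> = sform {..<Suc n * n} (\<lambda>u v. Phi (outer_block n P P (u mod n) (v mod n)) $$ (u div n, v div n)) ?w ?w
      - sform {..<Suc n * n} (\<lambda>u v. c * (?g u * cnj (?g v))) ?w ?w"
    by (rule sform_diff)
  also have "sform {..<Suc n * n} (\<lambda>u v. Phi (outer_block n P P (u mod n) (v mod n)) $$ (u div n, v div n)) ?w ?w
      = sform ?J (\<lambda>p q. Phi (outer_block n P P (snd p) (snd q)) $$ (fst p, fst q)) w w"
    using sform_reindex[OF bij_betw_div_mod[of n "Suc n"], of "\<lambda>p q. Phi (outer_block n P P (snd p) (snd q)) $$ (fst p, fst q)" w w]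
    by simp
  also have "sform {..<Suc n * n} (\<lambda>u v. c * (?g u * cnj (?g v))) ?w ?w
      = (\<Sum>u<Suc n * n. cnj (?w u) * ?g u) * (\<Sum>v<Suc n * n. c * (cnj (?g v) * ?w v))"
    unfolding sform_def sum_product by (intro sum.cong refl) (simp add: algebra_simps)
  also have "(\<Sum>u<Suc n * n. cnj (?w u) * ?g u) = 0"
  proof -
    let ?f = "\<lambda>p. cnj (w p) * (if fst p < n then P $$ p else 0)"
    have "(\<Sum>u<Suc n * n. cnj (?w u) * ?g u) = (\<Sum>u<Suc n * n. ?f (u div n, u mod n))"
    proof (intro sum.cong refl)
      fix u assume "u \<in> {..<Suc n * n}"
      then have "n > 0" by (cases n) auto
      then have "u < n * n \<longleftrightarrow> u div n < n" by (simp add: div_less_iff_less_mult)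
      then show "cnj (?w u) * ?g u = ?f (u div n, u mod n)" by simp
    qed
    also have "\<dots> = (\<Sum>p\<in>?J. ?f p)"
      by (rule sum.reindex_bij_betw[OF bij_betw_div_mod])
    also have "\<dots> = (\<Sum>x<Suc n. \<Sum>a<n. ?f (x,a))"
      unfolding sum.cartesian_product by (intro sum.cong) auto
    also have "\<dots> = 0" using orth by (simp add: w_def)
    finally show ?thesis .
  qed
  finally show ?thesis by simp
qed

lemma tamper_detect_LO_D:
  assumes "tamper_detect_LO dM d t Enc Dec \<epsilon>" "\<forall>i<t. cptp (d i) (d i) (Lam i)" "density dM \<sigma>"
  shows "\<exists>p. trace_norm (ext_id (Dec \<circ> lo_tensor d t Lam \<circ> Enc) dM (Suc dM) dM (canon_pur dM \<sigma>)
       - (complex_of_real p \<cdot>\<^sub>m pad (Suc dM * dM) (canon_pur dM \<sigma>)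
          + complex_of_real (1 - p) \<cdot>\<^sub>m kron (botm dM) (ptr_first dM dM (canon_pur dM \<sigma>)))) \<le> \<epsilon>"
  using assms unfolding tamper_detect_LO_def Let_def by blast

text \<open>The security error is squeezed between two bounds: \<open>tampered_overlap\<close> puts
  the squared trace below the form at \<open>F\<close>, and \<open>trace_norm_ge_form\<close> puts
  that form below the trace norm in the security condition.\<close>

lemma tamper_detect_overlap:
  assumes code: "is_code dM d t Enc Dec" and td: "tamper_detect_LO dM d t Enc Dec \<epsilon>"
    and B: "\<And>j. j < t \<Longrightarrow> unitary (d j) (B j)"
    and \<sigma>: "density dM \<sigma>" and P: "P = msqrt dM \<sigma>" and Pc: "P \<in> carrier_mat dM dM"
    and F: "F \<in> carrier_mat dM dM"
    and F1: "(\<Sum>x<dM. \<Sum>a<dM. (cmod (F $$ (x,a)))\<^sup>2) = 1"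
    and orth: "(\<Sum>x<dM. \<Sum>a<dM. cnj (F $$ (x,a)) * P $$ (x,a)) = 0"
  shows "(cmod (mtrace (tensor_mat d t B * Enc (P * cadj F))))\<^sup>2 \<le> \<epsilon>"
proof -
  let ?T = "tensor_mat d t B" and ?N = "tdim d t" and ?S = "canon_pur dM \<sigma>"
  let ?Lam = "\<lambda>j Z. B j * Z * cadj (B j)"
  from code have Enc: "cptp dM ?N Enc" and Dec: "cptp ?N (Suc dM) Dec"
    and id: "\<And>\<rho>. \<rho> \<in> carrier_mat dM dM \<Longrightarrow> Dec (Enc \<rho>) = pad (Suc dM) \<rho>"
    unfolding is_code_def by auto
  have Lam: "\<forall>i<t. cptp (d i) (d i) (?Lam i)" using B cptp_conj by blast
  obtain p where tn:
    "trace_norm (ext_id (Dec \<circ> lo_tensor d t ?Lam \<circ> Enc) dM (Suc dM) dM ?S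
       - (complex_of_real p \<cdot>\<^sub>m pad (Suc dM * dM) ?S
          + complex_of_real (1 - p) \<cdot>\<^sub>m kron (botm dM) (ptr_first dM dM ?S))) \<le> \<epsilon>"
    (is "trace_norm ?Y \<le> \<epsilon>")
    using tamper_detect_LO_D[OF td Lam \<sigma>] by blast
  let ?J = "{..<Suc dM} \<times> {..<dM}"
  let ?w = "\<lambda>p. if fst p < dM then F $$ p else 0"
  let ?w' = "\<lambda>u. ?w (u div dM, u mod dM)"
  let ?Phi = "Dec \<circ> lo_tensor d t ?Lam \<circ> Enc"
  have Phi: "?Phi Z = Dec (?T * Enc Z * cadj ?T)" if "Z \<in> carrier_mat dM dM" for Z
    using lo_tensor_conj[of t B d "Enc Z"] B cptpD(1)[OF Enc that] by (simp add: unitary_def)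
  have Y: "?Y \<in> carrier_mat (Suc dM * dM) (Suc dM * dM)"
    by (intro minus_carrier_mat) (simp add: kron_def botm_def ptr_first_def pad_def)
  have "(\<Sum>u<Suc dM * dM. (cmod (?w' u))\<^sup>2) = (\<Sum>p\<in>?J. (cmod (?w p))\<^sup>2)"
    by (rule sum.reindex_bij_betw[OF bij_betw_div_mod])
  also have "\<dots> = (\<Sum>x<Suc dM. \<Sum>a<dM. (cmod (?w (x,a)))\<^sup>2)"
    unfolding sum.cartesian_product by (intro sum.cong) auto
  also have "\<dots> = 1" using F1 by simp
  finally have w: "(\<Sum>u<Suc dM * dM. (cmod (?w' u))\<^sup>2) \<le> 1" by simp
  have "(cmod (mtrace (?T * Enc (P * cadj F))))\<^sup>2
    \<le> Re (sform ?J (\<lambda>p q. Dec (?T * Enc (outer_block dM P P (snd p) (snd q)) * cadj ?T) $$ (fst p, fst q)) ?w ?w)"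
    by (rule tampered_overlap[OF Enc Dec id tensor_mat_carrier Pc F F1])
  also have "\<dots> = Re (sform {..<Suc dM * dM} (\<lambda>u v. ?Y $$ (u,v)) ?w' ?w')"
    unfolding tampered_canon_pur_form[OF P F orth] by (simp add: Phi[symmetric])
  also have "\<dots> \<le> cmod (sform {..<Suc dM * dM} (\<lambda>u v. ?Y $$ (u,v)) ?w' ?w')"
    by (rule complex_Re_le_cmod)
  also have "\<dots> \<le> trace_norm ?Y" by (rule trace_norm_ge_form[OF Y w])
  finally show ?thesis using tn by simp
qed

text \<open>\<open>sqrt\<close> is negative on negative reals, so enlarging the factor in front of
  \<open>sqrt \<epsilon>\<close> is sound only for \<open>\<epsilon> \<ge> 0\<close>. Identity
  tampering exhibits a trace norm below \<open>\<epsilon>\<close>, and the zero test vector shows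
  that this trace norm is nonnegative.\<close>

lemma tamper_detect_error_nonneg:
  assumes td: "tamper_detect_LO dM d t Enc Dec \<epsilon>" and \<sigma>: "density dM \<sigma>"
  shows "\<epsilon> \<ge> 0"
proof -
  let ?Lam = "\<lambda>j Z. 1\<^sub>m (d j) * Z * cadj (1\<^sub>m (d j))" and ?S = "canon_pur dM \<sigma>"
  have Lam: "\<forall>i<t. cptp (d i) (d i) (?Lam i)" using cptp_conj[OF unitary_one] by blast
  obtain p where tn:
    "trace_norm (ext_id (Dec \<circ> lo_tensor d t ?Lam \<circ> Enc) dM (Suc dM) dM ?S
       - (complex_of_real p \<cdot>\<^sub>m pad (Suc dM * dM) ?S
          + complex_of_real (1 - p) \<cdot>\<^sub>m kron (botm dM) (ptr_first dM dM ?S))) \<le> \<epsilon>"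
    (is "trace_norm ?Y \<le> \<epsilon>")
    using tamper_detect_LO_D[OF td Lam \<sigma>] by blast
  have Y: "?Y \<in> carrier_mat (Suc dM * dM) (Suc dM * dM)"
    by (intro minus_carrier_mat) (simp add: kron_def botm_def ptr_first_def pad_def)
  have "0 \<le> cmod (sform {..<Suc dM * dM} (\<lambda>u v. ?Y $$ (u,v)) (\<lambda>_. 0) (\<lambda>_. 0))" by simp
  also have "\<dots> \<le> trace_norm ?Y" by (rule trace_norm_ge_form[OF Y]) simp
  finally show ?thesis using tn by simp
qed

section \<open>Spectrum of a difference of two states\<close>

lemma density_spec:
  assumes U: "unitary n U" and q: "\<And>k. k < n \<Longrightarrow> q k \<ge> 0" and s: "(\<Sum>k<n. q k) = 1"
  shows "density n (spec n U (\<lambda>k. complex_of_real (q k)))"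
proof -
  have "mtrace (spec n U (\<lambda>k. complex_of_real (q k))) = complex_of_real (\<Sum>k<n. q k)"
    unfolding mtrace_spec[OF U] by simp
  then show ?thesis
    unfolding density_def using psd_spec[OF unitaryD(1)[OF U] q] s by simp
qed

text \<open>The trace of \<open>\<rho>\<close> computed in the orthonormal basis of the columns of
  \<open>U\<close>.\<close>

lemma density_eigenbasis_sum:
  assumes U: "unitary n U" and \<rho>: "density n \<rho>"
  shows "(\<Sum>k<n. Re (sform {..<n} (\<lambda>i j. \<rho> $$ (i,j)) (\<lambda>i. U $$ (i,k)) (\<lambda>i. U $$ (i,k)))) = 1"
proof -
  note Uc = unitaryD[OF U]
  have \<rho>c: "\<rho> \<in> carrier_mat n n" using \<rho> by (simp add: density_def psd_def)
  have "(\<Sum>k<n. sform {..<n} (\<lambda>i j. \<rho> $$ (i,j)) (\<lambda>i. U $$ (i,k)) (\<lambda>i. U $$ (i,k))) = mtrace (cadj U * (\<rho> * U))"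
    unfolding sform_def mtrace_mult_sum[OF Uc(2) square_mult_carrier[OF \<rho>c Uc(1)]]
    using Uc(1) by (intro sum.cong refl) (auto simp: index_mult_mat_sum[OF \<rho>c Uc(1)] sum_distrib_left algebra_simps intro!: sum.cong)
  also have "\<dots> = mtrace (\<rho> * U * cadj U)"
    using \<rho>c Uc by (intro mtrace_mult_commute) auto
  also have "\<rho> * U * cadj U = \<rho>"
    using \<rho>c Uc(1,2) by (simp add: assoc_mult_mat[of _ n n _ n _ n] Uc(4) right_mult_one_mat[of _ n n])
  also have "mtrace \<rho> = 1" using \<rho> by (simp add: density_def)
  finally show ?thesis by (metis Re_sum one_complex.simps(1))
qed

text \<open>Each \<open>l k\<close> is the difference of the expectations of the two states at
  column \<open>k\<close> of \<open>U\<close>; both families of expectations are nonnegative and sum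
  to 1.\<close>

lemma density_diff_spectrum:
  assumes \<psi>: "density n \<psi>0" "density n \<psi>1" and U: "unitary n U"
    and D: "\<psi>0 - \<psi>1 = spec n U (\<lambda>k. complex_of_real (l k))"
  shows "(\<Sum>k<n. \<bar>l k\<bar>) \<le> 2" and "(\<Sum>k<n. l k) = 0"
proof -
  let ?u = "\<lambda>k i. U $$ (i,k)"
  let ?q = "\<lambda>\<rho> k. Re (sform {..<n} (\<lambda>i j. \<rho> $$ (i,j)) (?u k) (?u k))"
  have c: "\<psi>0 \<in> carrier_mat n n" "\<psi>1 \<in> carrier_mat n n" using \<psi> by (auto simp: density_def psd_def)
  have pos: "?q \<psi>0 k \<ge> 0" "?q \<psi>1 k \<ge> 0" for k
    using \<psi> by (auto simp: density_def psd_iff_pos_kernel pos_kernel_def)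
  have l: "l k = ?q \<psi>0 k - ?q \<psi>1 k" if k: "k < n" for k
  proof -
    have "complex_of_real (l k) = sform {..<n} (\<lambda>i j. (\<psi>0 - \<psi>1) $$ (i,j)) (?u k) (?u k)"
      unfolding D by (rule sform_spec_column[OF U k, symmetric])
    also have "\<dots> = sform {..<n} (\<lambda>i j. \<psi>0 $$ (i,j) - \<psi>1 $$ (i,j)) (?u k) (?u k)"
      using c by (intro sform_cong) auto
    finally show ?thesis unfolding sform_diff by (metis Re_complex_of_real minus_complex.simps(1))
  qed
  have "(\<Sum>k<n. \<bar>l k\<bar>) \<le> (\<Sum>k<n. ?q \<psi>0 k + ?q \<psi>1 k)"
    using pos by (intro sum_mono) (auto simp: l abs_le_iff intro: add_increasing add_increasing2)
  then show "(\<Sum>k<n. \<bar>l k\<bar>) \<le> 2"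
    by (simp add: sum.distrib density_eigenbasis_sum[OF U] \<psi>)
  have "(\<Sum>k<n. l k) = (\<Sum>k<n. ?q \<psi>0 k - ?q \<psi>1 k)" using l by (intro sum.cong) auto
  then show "(\<Sum>k<n. l k) = 0"
    by (simp add: sum_subtractf density_eigenbasis_sum[OF U] \<psi>)
qed

lemma cptp_diff:
  assumes Phi: "cptp n m Phi" and X: "X \<in> carrier_mat n n" and Y: "Y \<in> carrier_mat n n"
  shows "Phi (X - Y) = Phi X - Phi Y"
proof -
  have "X - Y = X + (- 1) \<cdot>\<^sub>m Y" using X Y by (intro eq_matI) auto
  then have "Phi (X - Y) = Phi X + (- 1) \<cdot>\<^sub>m Phi Y"
    using X Y by (simp add: cptpD(2,3)[OF Phi])
  also have "\<dots> = Phi X - Phi Y"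
    using cptpD(1)[OF Phi X] cptpD(1)[OF Phi Y] by (intro eq_matI) auto
  finally show ?thesis .
qed

lemma cadj_diff: "A \<in> carrier_mat n m \<Longrightarrow> B \<in> carrier_mat n m \<Longrightarrow> cadj (A - B) = cadj A - cadj B"
  by (intro eq_matI) auto

lemma cadj_ptr_keep:
  assumes X: "X \<in> carrier_mat (tdim d t) (tdim d t)"
  shows "cadj (ptr_keep d t i X) = ptr_keep d t i (cadj X)"
proof (rule eq_matI)
  fix a b assume "a < dim_row (ptr_keep d t i (cadj X))" "b < dim_col (ptr_keep d t i (cadj X))"
  then have ab: "a < d i" "b < d i" by (simp_all add: ptr_keep_def)
  show "cadj (ptr_keep d t i X) $$ (a,b) = ptr_keep d t i (cadj X) $$ (a,b)"
    using ab X unfolding ptr_keep_def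
    by (simp add: cnj_sum if_distrib[of cnj], subst sum.swap) (intro sum.cong refl; auto)
qed (simp_all add: ptr_keep_def)

lemma ptr_keep_diff:
  assumes "X \<in> carrier_mat (tdim d t) (tdim d t)" "Y \<in> carrier_mat (tdim d t) (tdim d t)"
  shows "ptr_keep d t i (X - Y) = ptr_keep d t i X - ptr_keep d t i Y"
  using assms unfolding ptr_keep_def
  by (intro eq_matI) (auto simp: sum_subtractf[symmetric] intro!: sum.cong)

theorem theorem9p1:
  fixes dM t :: nat and d :: "nat \<Rightarrow> nat"
    and Enc Dec :: "complex mat \<Rightarrow> complex mat" and \<epsilon> :: real
  assumes "is_code dM d t Enc Dec"
    and "tamper_detect_LO dM d t Enc Dec \<epsilon>"
  shows "\<forall>\<psi>0 \<psi>1. density dM \<psi>0 \<longrightarrow> density dM \<psi>1 \<longrightarrow> (\<forall>i<t.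
           trace_norm (ptr_keep d t i (Enc \<psi>0) - ptr_keep d t i (Enc \<psi>1)) \<le> 4 * sqrt \<epsilon>)"
proof (intro allI impI)
  fix \<psi>0 \<psi>1 i assume \<psi>: "density dM \<psi>0" "density dM \<psi>1" and i: "i < t"
  let ?N = "tdim d t"
  note eps = tamper_detect_error_nonneg[OF assms(2) \<psi>(1)]
  from assms(1) have Enc: "cptp dM ?N Enc" unfolding is_code_def by auto
  have psd: "psd dM \<psi>0" "psd dM \<psi>1" using \<psi> by (auto simp: density_def)
  have c: "\<psi>0 \<in> carrier_mat dM dM" "\<psi>1 \<in> carrier_mat dM dM" using psd by (auto simp: psd_def)
  define D where "D = \<psi>0 - \<psi>1"
  have Dc: "D \<in> carrier_mat dM dM" using c unfolding D_def by (intro minus_carrier_mat) auto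
  have Dh: "cadj D = D" unfolding D_def using c psd by (simp add: cadj_diff psd_hermitian)
  have Ec: "Enc \<psi>0 \<in> carrier_mat ?N ?N" "Enc \<psi>1 \<in> carrier_mat ?N ?N" "Enc D \<in> carrier_mat ?N ?N"
    using cptpD(1)[OF Enc] c Dc by auto
  have ED: "Enc D = Enc \<psi>0 - Enc \<psi>1" unfolding D_def by (rule cptp_diff[OF Enc c])
  have EDh: "cadj (Enc D) = Enc D"
    unfolding ED cadj_diff[OF Ec(1,2)] using psd by (simp add: psd_hermitian[OF cptp_psd[OF Enc]])
  let ?\<Delta> = "ptr_keep d t i (Enc D)"
  have \<Delta>: "ptr_keep d t i (Enc \<psi>0) - ptr_keep d t i (Enc \<psi>1) = ?\<Delta>"
    unfolding ED by (rule ptr_keep_diff[OF Ec(1,2), symmetric])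
  have \<Delta>c: "?\<Delta> \<in> carrier_mat (d i) (d i)" by (simp add: ptr_keep_def)
  have \<Delta>h: "cadj ?\<Delta> = ?\<Delta>" by (simp add: cadj_ptr_keep[OF Ec(3)] EDh)
  obtain A where A: "unitary (d i) A" and tnA: "complex_of_real (trace_norm ?\<Delta>) = mtrace (A * ?\<Delta>)"
    using trace_norm_hermitian_attained[OF \<Delta>c \<Delta>h] .
  \<comment> \<open>The attack applies the optimal distinguishing unitary to share \<open>i\<close>
    and leaves the other shares untouched.\<close>
  define B where "B = (\<lambda>j. if j = i then A else 1\<^sub>m (d j))"
  have B: "unitary (d j) (B j)" for j using A unitary_one by (simp add: B_def)
  let ?T = "tensor_mat d t B"
  have tn: "complex_of_real (trace_norm ?\<Delta>) = mtrace (?T * Enc D)"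
    unfolding tnA B_def using mtrace_tensor_mat_single[where d=d, OF i unitaryD(1)[OF A] Ec(3)] by simp
  obtain U l where U: "unitary dM U" and DU: "D = spec dM U (\<lambda>k. complex_of_real (l k))"
    using hermitian_spec[OF Dc Dh] by blast
  note Uc = unitaryD[OF U]
  define L where "L = (\<Sum>k<dM. \<bar>l k\<bar>)"
  have L2: "L \<le> 2" and l0: "(\<Sum>k<dM. l k) = 0"
    using density_diff_spectrum[OF \<psi> U DU[unfolded D_def]] by (simp_all add: L_def)
  have "cmod (mtrace (?T * Enc D)) \<le> L * sqrt \<epsilon>"
  \<comment> \<open>The message is normalised by \<open>L\<close>, so equal states are treated
    apart; then \<open>D\<close> and both sides are zero.\<close>
  proof (cases "L = 0")
    case True
    then have "l k = 0" if "k < dM" for k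
      using that unfolding L_def by (simp add: sum_nonneg_eq_0_iff)
    then have "D = 0\<^sub>m dM dM"
      unfolding DU using Uc(1) by (intro eq_matI) (auto simp: index_spec carrier_matD[OF spec_carrier])
    then show ?thesis
      using True by (simp add: cptp_zero[OF Enc] right_mult_zero_mat[of ?T ?N ?N] mtrace_def)
  next
    case False
    then have Lpos: "L > 0" by (simp add: L_def sum_nonneg order_less_le)
    define q where "q = (\<lambda>k. \<bar>l k\<bar> / L)"
    have q: "q k \<ge> 0" for k using Lpos by (simp add: q_def)
    have q1: "(\<Sum>k<dM. q k) = 1" unfolding q_def sum_divide_distrib[symmetric] using Lpos by (simp add: L_def)
    let ?\<sigma> = "spec dM U (\<lambda>k. complex_of_real (q k))"
    let ?P = "spec dM U (\<lambda>k. complex_of_real (sqrt (q k)))"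
    \<comment> \<open>The signs sit in \<open>?F\<close> alone: the weights of \<open>?P\<close> and
      \<open>?F\<close> multiply to \<open>l k / L\<close>, the spectrum of
      \<open>D / L\<close>.\<close>
    let ?F = "spec dM U (\<lambda>k. complex_of_real (sgn (l k) * sqrt (q k)))"
    have P: "?P = msqrt dM ?\<sigma>" by (rule msqrt_spec[OF U q, symmetric])
    have Pc: "?P \<in> carrier_mat dM dM" and Fc: "?F \<in> carrier_mat dM dM" using Uc(1) by auto
    have cF: "cadj ?F = ?F" unfolding cadj_spec[OF Uc(1)] by simp
    have sq: "sqrt (q k) * (sgn (l k) * sqrt (q k)) = l k / L" for k
    proof -
      have "sqrt (q k) * (sgn (l k) * sqrt (q k)) = sgn (l k) * (sqrt (q k) * sqrt (q k))" by simp
      also have "\<dots> = sgn (l k) * q k" using q[of k] by simp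
      finally show ?thesis by (simp add: q_def sgn_mult_abs)
    qed
    have PF: "?P * cadj ?F = spec dM U (\<lambda>k. complex_of_real (l k / L))"
      unfolding cF spec_mult[OF U] of_real_mult[symmetric] sq ..
    have DPF: "D = complex_of_real L \<cdot>\<^sub>m (?P * cadj ?F)"
      unfolding PF DU using Uc(1) Lpos
      by (intro eq_matI) (auto simp: index_spec sum_distrib_left carrier_matD[OF spec_carrier] intro!: sum.cong)
    have F1: "(\<Sum>x<dM. \<Sum>a<dM. (cmod (?F $$ (x,a)))\<^sup>2) = 1"
    proof -
      have "complex_of_real (\<Sum>x<dM. \<Sum>a<dM. (cmod (?F $$ (x,a)))\<^sup>2) = mtrace (cadj ?F * ?F)"
        unfolding mtrace_mult_sum[OF cadj_carrier[OF Fc] Fc] of_real_sum cnj_mult_self[symmetric]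
        by (subst sum.swap) (use Fc in \<open>auto intro!: sum.cong\<close>)
      also have "\<dots> = (\<Sum>k<dM. complex_of_real (q k))"
        unfolding cF spec_mult[OF U] mtrace_spec[OF U] of_real_mult[symmetric]
      proof (intro sum.cong refl arg_cong[of _ _ complex_of_real])
        fix k
        show "sgn (l k) * sqrt (q k) * (sgn (l k) * sqrt (q k)) = q k"
        proof -
          have "sgn (l k) * sqrt (q k) * (sgn (l k) * sqrt (q k)) = (sgn (l k) * sgn (l k)) * (sqrt (q k) * sqrt (q k))"
            by (simp only: mult.assoc mult.left_commute)
          also have "\<dots> = (sgn (l k) * sgn (l k)) * q k" using q[of k] by simp
          \<comment> \<open>Where \<open>l k = 0\<close> the sign is 0, but so is
            \<open>q k\<close>.\<close>
          also have "\<dots> = q k" by (cases "l k = 0") (auto simp: q_def sgn_if)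
          finally show ?thesis .
        qed
      qed
      also have "\<dots> = complex_of_real 1" unfolding of_real_sum[symmetric] q1 ..
      finally show ?thesis by (simp only: of_real_eq_iff)
    qed
    have orth: "(\<Sum>x<dM. \<Sum>a<dM. cnj (?F $$ (x,a)) * ?P $$ (x,a)) = 0"
    proof -
      have "(\<Sum>x<dM. \<Sum>a<dM. cnj (?F $$ (x,a)) * ?P $$ (x,a)) = mtrace (cadj ?F * ?P)"
        unfolding mtrace_mult_sum[OF cadj_carrier[OF Fc] Pc]
        by (subst sum.swap) (use Fc in \<open>auto intro!: sum.cong\<close>)
      also have "\<dots> = mtrace (?P * cadj ?F)"
        by (rule mtrace_mult_commute[OF cadj_carrier[OF Fc] Pc])
      \<comment> \<open>Orthogonality comes from the equal traces of the two states: the overlap is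
        the trace of \<open>D / L\<close>.\<close>
      also have "\<dots> = complex_of_real ((\<Sum>k<dM. l k) / L)"
        unfolding PF mtrace_spec[OF U] by (simp add: sum_divide_distrib)
      finally show ?thesis by (simp add: l0)
    qed
    have "(cmod (mtrace (?T * Enc (?P * cadj ?F))))\<^sup>2 \<le> \<epsilon>"
      by (rule tamper_detect_overlap[OF assms B density_spec[OF U q q1] P Pc Fc F1 orth])
    then have ov: "cmod (mtrace (?T * Enc (?P * cadj ?F))) \<le> sqrt \<epsilon>" by (rule real_le_rsqrt)
    have PFc: "?P * cadj ?F \<in> carrier_mat dM dM" using Pc Fc by simp
    have "Enc D = complex_of_real L \<cdot>\<^sub>m Enc (?P * cadj ?F)"
      by (subst DPF) (rule cptpD(3)[OF Enc PFc])
    then have "mtrace (?T * Enc D) = complex_of_real L * mtrace (?T * Enc (?P * cadj ?F))"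
      using cptpD(1)[OF Enc PFc]
      by (simp add: mult_smult_distrib[OF tensor_mat_carrier] mtrace_smult[of _ ?N])
    then have "cmod (mtrace (?T * Enc D)) = L * cmod (mtrace (?T * Enc (?P * cadj ?F)))"
      using Lpos by (simp add: norm_mult)
    then show ?thesis using ov Lpos by simp
  qed
  moreover have "trace_norm ?\<Delta> \<le> cmod (mtrace (?T * Enc D))"
    unfolding tn[symmetric] by simp
  ultimately have "trace_norm ?\<Delta> \<le> L * sqrt \<epsilon>" by simp
  \<comment> \<open>\<open>L \<le> 2\<close> leaves a factor 2 to spare.\<close>
  also have "\<dots> \<le> 4 * sqrt \<epsilon>" using L2 eps by (intro mult_right_mono) auto
  finally show "trace_norm (ptr_keep d t i (Enc \<psi>0) - ptr_keep d t i (Enc \<psi>1)) \<le> 4 * sqrt \<epsilon>"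
    unfolding \<Delta> .
qed

end
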